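(* Let $n\ge 1$ and $C\ge 1$ be integers and let $\epsilon>0$ be a constant. Let $X_1,\dots,X_n$ be independent random variables taking nonnegative integer values, such that for every $i\in\{1,\dots,n\}$ the support $\mathsf{supp}_i$ of $X_i$ satisfies $\mathsf{supp}_i\subseteq[0,C+1]$ and $0\in\mathsf{supp}_i$. Suppose each $X_i$ is accessible only through an oracle $\mathcal{O}_i$ which, on input two integers $(n_1,n_2)$, returns $\Pr[n_1\le X_i\le n_2]$ in constant time. Let $\Delta=\prod_{i=1}^n\Pr[X_i=0]$. Then there is a deterministic algorithm (an FPTAS) that outputs a number $\widetilde F$ with $(1-\epsilon)\Pr[\sum_{i=1}^n X_i\le C]\le \widetilde F\le(1+\epsilon)\Pr[\sum_{i=1}^n X_i\le C]$, and whose running time is $O\bigl(\frac{n^3}{\epsilon^2}\log(\frac{1}{\Delta})^2\log C\bigr)$.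
   Context: Computation model: real arithmetic operations are performed exactly in constant time and the oracles return exact real values. The support $\mathsf{supp}_i$ is the set of values taken by $X_i$ with positive probability.
   Formalization: The running time is proved as O(max(n, (n^3/ε^2) log(1/Δ)^2 log C)); the stated bound alone is 0 when C=1 or Δ=1 and falls below the n oracle calls needed (for ε<1) when Δ is near 1, so the maximum with n is added. *)

theory Defs
  imports "HOL-Probability.Probability"
begin

section \<open>A real RAM with oracles\<close>

text \<open>
  Algorithms are programs of a small imperative language over unbounded integers and exact reals.
  Every variable is an array indexed by integers, a scalar being an array used at index 0 only.

  The language has no real constants other than integers and no rounding of reals, so a program
  is a finite combinatorial object and unit cost arithmetic cannot be used to decode a real.
\<close>

type_synonym vname = string

datatype iexp =
    IConst int
  | IArr vname iexp
  | IAdd iexp iexp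
  | ISub iexp iexp
  | IHalf iexp

datatype rexp =
    ROfInt iexp
  | RArr vname iexp
  | RAdd rexp rexp
  | RSub rexp rexp
  | RMul rexp rexp
  | RDiv rexp rexp
  | Query iexp iexp iexp

datatype bexp =
    ILess iexp iexp
  | RLess rexp rexp
  | BNot bexp
  | BAnd bexp bexp

datatype com =
    Skip
  | IAssign vname iexp iexp
  | RAssign vname iexp rexp
  | Seq com com
  | Cond bexp com com
  | While bexp com

record state =
  ints :: "vname \<Rightarrow> int \<Rightarrow> int"
  reals :: "vname \<Rightarrow> int \<Rightarrow> real"

type_synonym oracle_fun = "int \<Rightarrow> int \<Rightarrow> int \<Rightarrow> real"

fun ival :: "state \<Rightarrow> iexp \<Rightarrow> int" where
  "ival s (IConst k) = k"
| "ival s (IArr x e) = ints s x (ival s e)"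
| "ival s (IAdd e1 e2) = ival s e1 + ival s e2"
| "ival s (ISub e1 e2) = ival s e1 - ival s e2"
| "ival s (IHalf e) = ival s e div 2"

fun rval :: "oracle_fun \<Rightarrow> state \<Rightarrow> rexp \<Rightarrow> real" where
  "rval Orc s (ROfInt e) = of_int (ival s e)"
| "rval Orc s (RArr x e) = reals s x (ival s e)"
| "rval Orc s (RAdd e1 e2) = rval Orc s e1 + rval Orc s e2"
| "rval Orc s (RSub e1 e2) = rval Orc s e1 - rval Orc s e2"
| "rval Orc s (RMul e1 e2) = rval Orc s e1 * rval Orc s e2"
| "rval Orc s (RDiv e1 e2) = rval Orc s e1 / rval Orc s e2"
| "rval Orc s (Query i a b) = Orc (ival s i) (ival s a) (ival s b)"

fun bval :: "oracle_fun \<Rightarrow> state \<Rightarrow> bexp \<Rightarrow> bool" where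
  "bval Orc s (ILess e1 e2) \<longleftrightarrow> ival s e1 < ival s e2"
| "bval Orc s (RLess e1 e2) \<longleftrightarrow> rval Orc s e1 < rval Orc s e2"
| "bval Orc s (BNot b) \<longleftrightarrow> \<not> bval Orc s b"
| "bval Orc s (BAnd b1 b2) \<longleftrightarrow> bval Orc s b1 \<and> bval Orc s b2"

text \<open>Each operation, memory access, comparison and query costs one time unit.\<close>

fun icost :: "iexp \<Rightarrow> nat" where
  "icost (IConst k) = 1"
| "icost (IArr x e) = 1 + icost e"
| "icost (IAdd e1 e2) = 1 + icost e1 + icost e2"
| "icost (ISub e1 e2) = 1 + icost e1 + icost e2"
| "icost (IHalf e) = 1 + icost e"

fun rcost :: "rexp \<Rightarrow> nat" where
  "rcost (ROfInt e) = 1 + icost e"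
| "rcost (RArr x e) = 1 + icost e"
| "rcost (RAdd e1 e2) = 1 + rcost e1 + rcost e2"
| "rcost (RSub e1 e2) = 1 + rcost e1 + rcost e2"
| "rcost (RMul e1 e2) = 1 + rcost e1 + rcost e2"
| "rcost (RDiv e1 e2) = 1 + rcost e1 + rcost e2"
| "rcost (Query i a b) = 1 + icost i + icost a + icost b"

fun bcost :: "bexp \<Rightarrow> nat" where
  "bcost (ILess e1 e2) = 1 + icost e1 + icost e2"
| "bcost (RLess e1 e2) = 1 + rcost e1 + rcost e2"
| "bcost (BNot b) = 1 + bcost b"
| "bcost (BAnd b1 b2) = 1 + bcost b1 + bcost b2"

definition iwrite :: "vname \<Rightarrow> int \<Rightarrow> int \<Rightarrow> state \<Rightarrow> state" where
  "iwrite x k v s = s\<lparr>ints := (ints s)(x := (ints s x)(k := v))\<rparr>"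

definition rwrite :: "vname \<Rightarrow> int \<Rightarrow> real \<Rightarrow> state \<Rightarrow> state" where
  "rwrite x k v s = s\<lparr>reals := (reals s)(x := (reals s x)(k := v))\<rparr>"

text \<open>
  \<open>exec Orc c s t s'\<close>: started in \<open>s\<close> with queries answered by \<open>Orc\<close>, the program \<open>c\<close> halts in \<open>s'\<close> after
  exactly \<open>t\<close> time units.
\<close>

inductive exec :: "oracle_fun \<Rightarrow> com \<Rightarrow> state \<Rightarrow> nat \<Rightarrow> state \<Rightarrow> bool" for Orc :: oracle_fun where
  exec_Skip: "exec Orc Skip s 1 s"
| exec_IAssign:
    "exec Orc (IAssign x i e) s (1 + icost i + icost e) (iwrite x (ival s i) (ival s e) s)"
| exec_RAssign:
    "exec Orc (RAssign x i e) s (1 + icost i + rcost e) (rwrite x (ival s i) (rval Orc s e) s)"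
| exec_Seq:
    "exec Orc c1 s t1 s1 \<Longrightarrow> exec Orc c2 s1 t2 s2 \<Longrightarrow> exec Orc (Seq c1 c2) s (t1 + t2) s2"
| exec_CondTrue:
    "bval Orc s b \<Longrightarrow> exec Orc c1 s t s' \<Longrightarrow> exec Orc (Cond b c1 c2) s (1 + bcost b + t) s'"
| exec_CondFalse:
    "\<not> bval Orc s b \<Longrightarrow> exec Orc c2 s t s' \<Longrightarrow> exec Orc (Cond b c1 c2) s (1 + bcost b + t) s'"
| exec_WhileFalse:
    "\<not> bval Orc s b \<Longrightarrow> exec Orc (While b c) s (1 + bcost b) s"
| exec_WhileTrue:
    "bval Orc s b \<Longrightarrow> exec Orc c s t1 s1 \<Longrightarrow> exec Orc (While b c) s1 t2 s2 \<Longrightarrow>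
     exec Orc (While b c) s (1 + bcost b + t1 + t2) s2"

inductive_cases exec_SkipE: "exec Orc Skip s t s'"
inductive_cases exec_IAssignE: "exec Orc (IAssign x i e) s t s'"
inductive_cases exec_RAssignE: "exec Orc (RAssign x i e) s t s'"
inductive_cases exec_SeqE: "exec Orc (Seq c1 c2) s t s'"
inductive_cases exec_CondE: "exec Orc (Cond b c1 c2) s t s'"
inductive_cases exec_WhileE: "exec Orc (While b c) s t s'"

lemma exec_deterministic:
  "exec Orc c s t s' \<Longrightarrow> exec Orc c s u s'' \<Longrightarrow> t = u \<and> s' = s''"
proof (induction arbitrary: u s'' rule: exec.induct)
  case (exec_Seq c1 s t1 s1 c2 t2 s2)
  from exec_Seq.prems show ?case
    by (rule exec_SeqE) (metis exec_Seq.IH)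
next
  case (exec_CondTrue s b c1 t s' c2)
  from exec_CondTrue.prems show ?case
    by (rule exec_CondE) (auto simp: exec_CondTrue.hyps(1) dest!: exec_CondTrue.IH)
next
  case (exec_CondFalse s b c2 t s' c1)
  from exec_CondFalse.prems show ?case
    by (rule exec_CondE) (auto simp: exec_CondFalse.hyps(1) dest!: exec_CondFalse.IH)
next
  case (exec_WhileFalse s b c)
  from exec_WhileFalse.prems show ?case
    by (rule exec_WhileE) (use exec_WhileFalse.hyps in simp_all)
next
  case (exec_WhileTrue s b c t1 s1 t2 s2)
  from exec_WhileTrue.prems show ?case
    by (rule exec_WhileE) (auto simp: exec_WhileTrue.hyps(1) dest!: exec_WhileTrue.IH)
qed (erule exec_SkipE exec_IAssignE exec_RAssignE, simp)+

definition input_state :: "nat \<Rightarrow> nat \<Rightarrow> real \<Rightarrow> state" where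
  "input_state n C \<epsilon> =
     \<lparr>ints = (\<lambda>x k. if k \<noteq> 0 then 0 else if x = ''n'' then int n else if x = ''C'' then int C else 0),
      reals = (\<lambda>x k. if k = 0 \<and> x = ''eps'' then \<epsilon> else 0)\<rparr>"

definition result :: "state \<Rightarrow> real" where
  "result s = reals s ''out'' 0"


section \<open>Sums of independent random variables\<close>

definition supp :: "'a measure \<Rightarrow> ('a \<Rightarrow> nat) \<Rightarrow> nat set" where
  "supp M Y = {k. measure M {\<omega> \<in> space M. Y \<omega> = k} > 0}"

definition interval_oracle :: "'a measure \<Rightarrow> nat \<Rightarrow> (nat \<Rightarrow> 'a \<Rightarrow> nat) \<Rightarrow> oracle_fun" where
  "interval_oracle M n X i n1 n2 =
     (if 1 \<le> i \<and> i \<le> int n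
      then measure M {\<omega> \<in> space M. n1 \<le> int (X (nat i) \<omega>) \<and> int (X (nat i) \<omega>) \<le> n2}
      else 0)"

definition zero_prob :: "'a measure \<Rightarrow> nat \<Rightarrow> (nat \<Rightarrow> 'a \<Rightarrow> nat) \<Rightarrow> real" where
  "zero_prob M n X = (\<Prod>i = 1..n. measure M {\<omega> \<in> space M. X i \<omega> = 0})"

definition sum_prob :: "'a measure \<Rightarrow> nat \<Rightarrow> (nat \<Rightarrow> 'a \<Rightarrow> nat) \<Rightarrow> nat \<Rightarrow> real" where
  "sum_prob M n X C = measure M {\<omega> \<in> space M. (\<Sum>i = 1..n. X i \<omega>) \<le> C}"

text \<open>
  The bound proper is the second argument of the maximum. It vanishes for \<open>C = 1\<close> and for
  \<open>\<Delta> = 1\<close>, and is arbitrarily small for \<open>\<Delta>\<close> close to 1, whereas for \<open>\<epsilon> < 1\<close> every algorithm has to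
  query all \<open>n\<close> oracles; hence the maximum with \<open>n\<close>. For \<open>C \<ge> 2\<close> and \<open>ln (1 / \<Delta>) \<ge> \<epsilon>\<close> (for
  instance \<open>\<epsilon> \<le> 1/2\<close> and \<open>\<Delta> \<le> 1/2\<close>) the second argument is at least \<open>n ^ 3 * ln 2\<close>, so that up to a
  constant factor the maximum is the second argument.
\<close>

definition time_bound :: "nat \<Rightarrow> nat \<Rightarrow> real \<Rightarrow> real \<Rightarrow> real" where
  "time_bound n C \<epsilon> \<Delta> = max (real n) (real n ^ 3 / \<epsilon>\<^sup>2 * (ln (1 / \<Delta>))\<^sup>2 * ln (real C))"

end

theory Submission
  imports Defs
begin

text \<open>
  Let \<open>F\<^sub>i x\<close> be the probability that the first \<open>i\<close> variables sum to at most \<open>x\<close>. The algorithm keeps a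
  step function \<open>G\<^sub>i\<close> with \<open>G\<^sub>i \<le> F\<^sub>i \<le> r ^ i * G\<^sub>i\<close> on \<open>[0, C]\<close>, where \<open>r = 1 + \<epsilon> / (2 * n)\<close>, so that
  \<open>r ^ n \<le> 1 + \<epsilon>\<close>. Convolving \<open>G\<^sub>i\<close> with the law of the next variable preserves the inequalities and
  gives a monotone function \<open>H\<close> whose value at a point costs one query per jump of \<open>G\<^sub>i\<close>. The next
  step function is a greedy sparsification of \<open>H\<close>: from a breakpoint with value \<open>v\<close>, bisection
  finds the next point where \<open>H\<close> exceeds \<open>r * v\<close>. As \<open>H 0\<close> is the exact probability that all
  variables so far vanish, hence at least \<open>\<Delta>\<close>, and \<open>H \<le> 1\<close>, there are \<open>O(n * ln (1 / \<Delta>) / \<epsilon>)\<close>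
  breakpoints, each found with \<open>O(ln C)\<close> evaluations.

  For \<open>\<epsilon> \<ge> 1\<close> the answer 0 is good enough, and for \<open>\<Delta> \<ge> 1 - \<epsilon>\<close> the answer \<open>\<Delta>\<close> is. In the remaining
  case \<open>ln (1 / \<Delta>) > \<epsilon>\<close>, so that additive constants are absorbed by the bound.
\<close>

section \<open>Timed execution\<close>

text \<open>
  The postcondition receives the exact running time, so that the rules for straight-line code are
  equations.
\<close>

definition runs :: "oracle_fun \<Rightarrow> com \<Rightarrow> state \<Rightarrow> (nat \<Rightarrow> state \<Rightarrow> bool) \<Rightarrow> bool" where
  "runs Orc c s Q \<longleftrightarrow> (\<exists>t s'. exec Orc c s t s' \<and> Q t s')"

lemma runs_mono:
  assumes "runs Orc c s Q" and "\<And>t s'. Q t s' \<Longrightarrow> Q' t s'"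
  shows "runs Orc c s Q'"
  using assms unfolding runs_def by blast

lemma runs_Skip [simp]: "runs Orc Skip s Q \<longleftrightarrow> Q 1 s"
  unfolding runs_def by (metis exec_Skip exec_deterministic)

lemma runs_IAssign [simp]:
  "runs Orc (IAssign x i e) s Q \<longleftrightarrow> Q (1 + icost i + icost e) (iwrite x (ival s i) (ival s e) s)"
  unfolding runs_def by (metis exec_IAssign exec_deterministic)

lemma runs_RAssign [simp]:
  "runs Orc (RAssign x i e) s Q \<longleftrightarrow> Q (1 + icost i + rcost e) (rwrite x (ival s i) (rval Orc s e) s)"
  unfolding runs_def by (metis exec_RAssign exec_deterministic)

lemma runs_Seq [simp]:
  "runs Orc (Seq c1 c2) s Q \<longleftrightarrow> runs Orc c1 s (\<lambda>t1 s1. runs Orc c2 s1 (\<lambda>t2. Q (t1 + t2)))"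
  unfolding runs_def by (blast intro: exec_Seq elim: exec_SeqE)

lemma runs_Cond [simp]:
  "runs Orc (Cond b c1 c2) s Q \<longleftrightarrow>
     runs Orc (if bval Orc s b then c1 else c2) s (\<lambda>t. Q (1 + bcost b + t))"
proof (cases "bval Orc s b")
  case True
  have "exec Orc (Cond b c1 c2) s t s' \<longleftrightarrow> (\<exists>t'. t = 1 + bcost b + t' \<and> exec Orc c1 s t' s')" for t s'
    using True by (auto elim!: exec_CondE simp: exec_CondTrue[unfolded plus_1_eq_Suc add_Suc])
  with True show ?thesis unfolding runs_def by auto
next
  case False
  have "exec Orc (Cond b c1 c2) s t s' \<longleftrightarrow> (\<exists>t'. t = 1 + bcost b + t' \<and> exec Orc c2 s t' s')" for t s'
    using False by (auto elim!: exec_CondE simp: exec_CondFalse[unfolded plus_1_eq_Suc add_Suc])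
  with False show ?thesis unfolding runs_def by auto
qed

text \<open>The index \<open>k\<close> of the invariant is a variant: its strict decrease proves
  termination and bounds the number of iterations. The extra 1 in \<open>k + 1\<close> pays for the
  final failing test.\<close>

lemma runs_While:
  assumes step: "\<And>k s. I k s \<Longrightarrow> bval Orc s b \<Longrightarrow> runs Orc c s (\<lambda>t s'. t \<le> T \<and> (\<exists>k'<k. I k' s'))"
    and init: "I k s"
  shows "runs Orc (While b c) s
    (\<lambda>t s'. t \<le> (k + 1) * (1 + bcost b + T) \<and> \<not> bval Orc s' b \<and> (\<exists>k'. I k' s'))"
  using init
proof (induction k arbitrary: s rule: less_induct)
  case (less k)
  show ?case
  proof (cases "bval Orc s b")
    case False
    with less.prems show ?thesis
      unfolding runs_def using exec_WhileFalse[of Orc s b c]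
      by (intro exI[of _ "1 + bcost b"] exI[of _ s]) auto
  next
    case True
    from step[OF less.prems True] obtain t1 s1 k'
      where 1: "exec Orc c s t1 s1" "t1 \<le> T" "k' < k" "I k' s1"
      unfolding runs_def by blast
    from less.IH[OF 1(3,4)] obtain t2 s2 where
      2: "exec Orc (While b c) s1 t2 s2" "t2 \<le> (k' + 1) * (1 + bcost b + T)"
         "\<not> bval Orc s2 b" "\<exists>k'. I k' s2"
      unfolding runs_def by blast
    have "(k' + 1) * (1 + bcost b + T) \<le> k * (1 + bcost b + T)"
      using 1(3) by (intro mult_le_mono1) simp
    with 1 2 have "1 + bcost b + t1 + t2 \<le> (k + 1) * (1 + bcost b + T)"
      by simp
    with exec_WhileTrue[OF True 1(1) 2(1)] 2 show ?thesis
      unfolding runs_def by blast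
  qed
qed

section \<open>Frame conditions: which arrays a program may change\<close>

definition same_except :: "vname set \<Rightarrow> vname set \<Rightarrow> state \<Rightarrow> state \<Rightarrow> bool" where
  "same_except A B s s' \<longleftrightarrow>
     (\<forall>x. x \<notin> A \<longrightarrow> ints s' x = ints s x) \<and> (\<forall>x. x \<notin> B \<longrightarrow> reals s' x = reals s x)"

lemma ints_iwrite [simp]: "ints (iwrite x k v s) = (ints s)(x := (ints s x)(k := v))"
  and ints_rwrite [simp]: "ints (rwrite x k v' s) = ints s"
  and reals_iwrite [simp]: "reals (iwrite x k v s) = reals s"
  and reals_rwrite [simp]: "reals (rwrite x k v' s) = (reals s)(x := (reals s x)(k := v'))"
  by (simp_all add: iwrite_def rwrite_def)

section \<open>The program\<close>

abbreviation ivar :: "vname \<Rightarrow> iexp" where "ivar x \<equiv> IArr x (IConst 0)"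
abbreviation rvar :: "vname \<Rightarrow> rexp" where "rvar x \<equiv> RArr x (IConst 0)"
abbreviation iset :: "vname \<Rightarrow> iexp \<Rightarrow> com" where "iset x e \<equiv> IAssign x (IConst 0) e"
abbreviation rset :: "vname \<Rightarrow> rexp \<Rightarrow> com" where "rset x e \<equiv> RAssign x (IConst 0) e"

text \<open>
  All layers are stored one after the other in the arrays \<open>b\<close> (breakpoints) and \<open>w\<close> (jump heights):
  the current layer occupies the indices from \<open>st\<close> to \<open>en - 1\<close>, and the layer under construction
  those from \<open>en\<close> to \<open>top - 1\<close>.
\<close>

definition eval_prog :: com where
  "eval_prog =
     Seq (iset ''j'' (ivar ''st''))
    (Seq (rset ''h'' (ROfInt (IConst 0)))
    (While (ILess (ivar ''j'') (ivar ''en''))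
      (Seq (rset ''h'' (RAdd (rvar ''h'') (RMul (RArr ''w'' (ivar ''j''))
              (Query (ivar ''i'') (IConst 0) (ISub (ivar ''x'') (IArr ''b'' (ivar ''j'')))))))
           (iset ''j'' (IAdd (ivar ''j'') (IConst 1))))))"

definition search_prog :: com where
  "search_prog =
     While (ILess (IAdd (ivar ''lo'') (IConst 1)) (ivar ''hi''))
      (Seq (iset ''x'' (IHalf (IAdd (ivar ''lo'') (ivar ''hi''))))
      (Seq eval_prog
           (Cond (RLess (RMul (rvar ''r'') (rvar ''v'')) (rvar ''h''))
             (iset ''hi'' (ivar ''x''))
             (iset ''lo'' (ivar ''x'')))))"

text \<open>\<open>v\<close> is the level reached at the last breakpoint, so the jump height is
  \<open>h - v\<close>. Started with \<open>v = 0\<close>, the same code installs the first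
  breakpoint.\<close>

definition append_prog :: com where
  "append_prog =
     Seq (IAssign ''b'' (ivar ''top'') (ivar ''x''))
    (Seq (RAssign ''w'' (ivar ''top'') (RSub (rvar ''h'') (rvar ''v'')))
    (Seq (rset ''v'' (rvar ''h''))
         (iset ''top'' (IAdd (ivar ''top'') (IConst 1)))))"

text \<open>\<open>hC\<close> caches the value at \<open>C\<close>. When the guard holds, the last
  breakpoint and \<open>C\<close> bracket the next crossing of \<open>r * v\<close>.\<close>

definition extend_prog :: com where
  "extend_prog =
     While (RLess (RMul (rvar ''r'') (rvar ''v'')) (rvar ''hC''))
      (Seq (iset ''lo'' (IArr ''b'' (ISub (ivar ''top'') (IConst 1))))
      (Seq (iset ''hi'' (ivar ''C''))
      (Seq search_prog
      (Seq (iset ''x'' (ivar ''hi''))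
      (Seq eval_prog append_prog)))))"

definition layer_prog :: com where
  "layer_prog =
     Seq (iset ''i'' (IAdd (ivar ''i'') (IConst 1)))
    (Seq (iset ''top'' (ivar ''en''))
    (Seq (iset ''x'' (ivar ''C''))
    (Seq eval_prog
    (Seq (rset ''hC'' (rvar ''h''))
    (Seq (iset ''x'' (IConst 0))
    (Seq eval_prog
    (Seq (rset ''v'' (ROfInt (IConst 0)))
    (Seq append_prog
    (Seq extend_prog
    (Seq (iset ''st'' (ivar ''en''))
         (iset ''en'' (ivar ''top''))))))))))))"

definition zero_prog :: com where
  "zero_prog =
     Seq (rset ''d'' (ROfInt (IConst 1)))
    (While (ILess (ivar ''i'') (ivar ''n''))
      (Seq (iset ''i'' (IAdd (ivar ''i'') (IConst 1)))
           (rset ''d'' (RMul (rvar ''d'') (Query (ivar ''i'') (IConst 0) (IConst 0))))))"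

text \<open>The first layer is the constant 1; its breakpoint \<open>b[0] = 0\<close> and \<open>st = 0\<close> are initial values.\<close>

definition layers_prog :: com where
  "layers_prog =
     Seq (rset ''r'' (RAdd (ROfInt (IConst 1))
            (RDiv (rvar ''eps'') (ROfInt (IAdd (ivar ''n'') (ivar ''n''))))))
    (Seq (rset ''w'' (ROfInt (IConst 1)))
    (Seq (iset ''en'' (IConst 1))
    (Seq (iset ''i'' (IConst 0))
         (While (ILess (ivar ''i'') (ivar ''n'')) layer_prog))))"

text \<open>\<open>Skip\<close> answers 0, the initial value of \<open>out\<close>.\<close>

definition fptas_prog :: com where
  "fptas_prog =
     Cond (RLess (rvar ''eps'') (ROfInt (IConst 1)))
       (Seq zero_prog
         (Cond (RLess (rvar ''d'') (RSub (ROfInt (IConst 1)) (rvar ''eps'')))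
           (Seq layers_prog (rset ''out'' (rvar ''v'')))
           (rset ''out'' (rvar ''d''))))
       Skip"

text \<open>With \<open>q\<close> the distribution function of a nonnegative integer variable, this
  is the convolution of its law with the step function jumping by \<open>w j\<close> at
  \<open>b j\<close>. Summing over jumps makes the cost independent of \<open>x\<close>.\<close>

definition conv :: "(int \<Rightarrow> real) \<Rightarrow> (int \<Rightarrow> int) \<Rightarrow> (int \<Rightarrow> real) \<Rightarrow> int \<Rightarrow> int \<Rightarrow> int \<Rightarrow> real" where
  "conv q b w st en x = (\<Sum>j\<in>{st..<en}. w j * q (x - b j))"

lemma atLeastLessThan_plus1_int: "st \<le> k \<Longrightarrow> {st..<k + 1} = insert k {st..<k}" for k :: int
  by auto

lemma runs_eval_prog:
  assumes "ints s ''st'' 0 \<le> ints s ''en'' 0" "ints s ''en'' 0 - ints s ''st'' 0 \<le> int N"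
  shows "runs Orc eval_prog s (\<lambda>t s'. t \<le> 40 * (N + 1) \<and> same_except {''j''} {''h''} s s' \<and>
     reals s' ''h'' 0 = conv (Orc (ints s ''i'' 0) 0) (ints s ''b'') (reals s ''w'')
        (ints s ''st'' 0) (ints s ''en'' 0) (ints s ''x'' 0))"
proof -
  define st en where "st = ints s ''st'' 0" and "en = ints s ''en'' 0"
  note se = st_def en_def
  define I where "I = (\<lambda>k s'. same_except {''j''} {''h''} s s' \<and> int k = en - ints s' ''j'' 0 \<and>
     st \<le> ints s' ''j'' 0 \<and>
     reals s' ''h'' 0 = conv (Orc (ints s ''i'' 0) 0) (ints s ''b'') (reals s ''w'')
        st (ints s' ''j'' 0) (ints s ''x'' 0))"
  show ?thesis
    unfolding eval_prog_def runs_Seq runs_IAssign runs_RAssign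
    apply (rule runs_mono)
     apply (rule runs_While[where I = I and T = 25 and k = "nat (en - st)"])
    subgoal for k s'
      by (auto intro!: exI[of _ "k - 1"]
          simp: I_def same_except_def conv_def se atLeastLessThan_plus1_int)
    subgoal using assms by (auto simp: I_def same_except_def conv_def se)
    subgoal premises prems for t s'
    proof -
      obtain k' where I: "I k' s'" and "en \<le> ints s' ''j'' 0"
        using prems by (auto simp: I_def same_except_def se)
      then have "ints s' ''j'' 0 = en" by (simp add: I_def)
      then show ?thesis using I prems assms by (auto simp: I_def se)
    qed
    done
qed

text \<open>Bisection preserves the bracket \<open>H lo \<le> c < H hi\<close>, and a bracket of
  width 1 is a crossing of \<open>c\<close>. For monotone \<open>H\<close> it is the only
  one.\<close>

lemma runs_search_prog:
  fixes s Orc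
  defines "H \<equiv> conv (Orc (ints s ''i'' 0) 0) (ints s ''b'') (reals s ''w'') (ints s ''st'' 0) (ints s ''en'' 0)"
  defines "c \<equiv> reals s ''r'' 0 * reals s ''v'' 0"
  assumes "ints s ''st'' 0 \<le> ints s ''en'' 0" "ints s ''en'' 0 - ints s ''st'' 0 \<le> int N"
    and "ints s ''lo'' 0 < ints s ''hi'' 0" "ints s ''hi'' 0 - ints s ''lo'' 0 \<le> 2 ^ g"
    and "H (ints s ''lo'' 0) \<le> c" "c < H (ints s ''hi'' 0)"
  shows "runs Orc search_prog s (\<lambda>t s'. t \<le> 80 * ((g + 1) * (N + 1)) \<and>
     same_except {''lo'', ''hi'', ''x'', ''j''} {''h''} s s' \<and>
     ints s ''lo'' 0 < ints s' ''hi'' 0 \<and> ints s' ''hi'' 0 \<le> ints s ''hi'' 0 \<and>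
     H (ints s' ''hi'' 0 - 1) \<le> c \<and> c < H (ints s' ''hi'' 0))"
proof -
  define I where "I = (\<lambda>k s'. same_except {''lo'', ''hi'', ''x'', ''j''} {''h''} s s' \<and>
     ints s ''lo'' 0 \<le> ints s' ''lo'' 0 \<and> ints s' ''lo'' 0 < ints s' ''hi'' 0 \<and>
     ints s' ''hi'' 0 \<le> ints s ''hi'' 0 \<and> ints s' ''hi'' 0 - ints s' ''lo'' 0 \<le> 2 ^ k \<and>
     H (ints s' ''lo'' 0) \<le> c \<and> c < H (ints s' ''hi'' 0))"
  have step: "runs Orc
      (Seq (iset ''x'' (IHalf (IAdd (ivar ''lo'') (ivar ''hi''))))
      (Seq eval_prog
           (Cond (RLess (RMul (rvar ''r'') (rvar ''v'')) (rvar ''h''))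
             (iset ''hi'' (ivar ''x''))
             (iset ''lo'' (ivar ''x''))))) s'
      (\<lambda>t s''. t \<le> 40 * (N + 1) + 25 \<and> (\<exists>k'<k. I k' s''))"
    if I: "I k s'" and b: "bval Orc s' (ILess (IAdd (ivar ''lo'') (IConst 1)) (ivar ''hi''))" for k s'
  proof -
    define lo hi m where "lo = ints s' ''lo'' 0" and "hi = ints s' ''hi'' 0" and "m = (lo + hi) div 2"
    have lt: "lo + 1 < hi" using b by (simp add: lo_def hi_def)
    \<comment> \<open>A bracket of width at most \<open>2 ^ 0\<close> would fail the loop
      test.\<close>
    have "k \<noteq> 0"
    proof
      assume "k = 0"
      with I have "hi - lo \<le> 1" by (simp add: I_def lo_def hi_def)
      with lt show False by simp
    qed
    then obtain k' where k: "k = Suc k'" by (cases k) auto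
    \<comment> \<open>The longer half is \<open>(hi - lo) / 2\<close> rounded up; as the bound is
      even, rounding cannot exceed \<open>2 ^ k'\<close>.\<close>
    have "hi - lo \<le> 2 * 2 ^ k'" using I by (simp add: I_def lo_def hi_def k)
    then have m: "lo < m" "m < hi" "hi - m \<le> 2 ^ k'" "m - lo \<le> 2 ^ k'"
      using lt unfolding m_def by linarith+
    define s1 where "s1 = iwrite ''x'' 0 m s'"
    have R: "runs Orc eval_prog s1 (\<lambda>t s''. t \<le> 40 * (N + 1) \<and>
       same_except {''j''} {''h''} s1 s'' \<and> reals s'' ''h'' 0 = H m)"
      using runs_eval_prog[of s1 N Orc] I assms(3,4)
      by (simp add: s1_def I_def same_except_def H_def)
    show ?thesis
      apply (simp add: lo_def[symmetric] hi_def[symmetric] m_def[symmetric] s1_def[symmetric])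
      apply (rule runs_mono[OF R])
      using I m k
      by (auto simp: I_def same_except_def s1_def c_def lo_def hi_def intro!: exI[of _ k'])
  qed
  have *: "runs Orc search_prog s
    (\<lambda>t s'. t \<le> (g + 1) * (1 + 7 + (40 * (N + 1) + 25)) \<and>
        \<not> bval Orc s' (ILess (IAdd (ivar ''lo'') (IConst 1)) (ivar ''hi'')) \<and> (\<exists>k'. I k' s'))"
    unfolding search_prog_def
    apply (rule runs_mono)
     apply (rule runs_While[where I = I and k = g, OF step])
       apply assumption
      apply assumption
    using assms by (auto simp: I_def same_except_def)
  have le: "(g + 1) * (1 + 7 + (40 * (N + 1) + 25)) \<le> 80 * ((g + 1) * (N + 1))"
    by (simp add: algebra_simps)
  show ?thesis
  proof (rule runs_mono[OF *])
    fix t s'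
    assume *: "t \<le> (g + 1) * (1 + 7 + (40 * (N + 1) + 25)) \<and>
        \<not> bval Orc s' (ILess (IAdd (ivar ''lo'') (IConst 1)) (ivar ''hi'')) \<and> (\<exists>k'. I k' s')"
    then obtain k' where I: "I k' s'" by blast
    have "ints s' ''lo'' 0 = ints s' ''hi'' 0 - 1" using * I by (simp add: I_def)
    with I * le show "t \<le> 80 * ((g + 1) * (N + 1)) \<and>
     same_except {''lo'', ''hi'', ''x'', ''j''} {''h''} s s' \<and>
     ints s ''lo'' 0 < ints s' ''hi'' 0 \<and> ints s' ''hi'' 0 \<le> ints s ''hi'' 0 \<and>
     H (ints s' ''hi'' 0 - 1) \<le> c \<and> c < H (ints s' ''hi'' 0)"
      by (auto simp: I_def)
  qed
qed

section \<open>Step functions and their sparsification\<close>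

definition step_fun :: "(int \<Rightarrow> int) \<Rightarrow> (int \<Rightarrow> real) \<Rightarrow> int \<Rightarrow> int \<Rightarrow> int \<Rightarrow> real" where
  "step_fun b w st en y = (\<Sum>j\<in>{st..<en}. if b j \<le> y then w j else 0)"

text \<open>Exchange of sums: the mass \<open>p k\<close> meets the jump at \<open>b j\<close>
  exactly when \<open>b j \<le> x - k\<close>. Nonnegative breakpoints keep these \<open>k\<close>
  inside \<open>{0..x}\<close>.\<close>

lemma conv_eq_step_fun:
  assumes q: "\<And>y. q y = (\<Sum>k\<in>{0..y}. p k)" and b: "\<And>j. j \<in> {st..<en} \<Longrightarrow> 0 \<le> b j"
  shows "conv q b w st en x = (\<Sum>k\<in>{0..x}. p k * step_fun b w st en (x - k))"
proof -
  have "w j * q (x - b j) = (\<Sum>k\<in>{0..x}. p k * (if b j \<le> x - k then w j else 0))"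
    if "j \<in> {st..<en}" for j
  proof -
    have "{0..x - b j} = {k \<in> {0..x}. b j \<le> x - k}" using b[OF that] by auto
    then have "q (x - b j) = (\<Sum>k\<in>{0..x}. if b j \<le> x - k then p k else 0)"
      unfolding q by (simp only: sum.inter_filter finite_atLeastAtMost_int)
    then show ?thesis by (auto simp: sum_distrib_left intro!: sum.cong)
  qed
  then have "conv q b w st en x =
      (\<Sum>j\<in>{st..<en}. \<Sum>k\<in>{0..x}. p k * (if b j \<le> x - k then w j else 0))"
    by (simp add: conv_def)
  also have "\<dots> = (\<Sum>k\<in>{0..x}. p k * step_fun b w st en (x - k))"
    unfolding step_fun_def sum_distrib_left by (rule sum.swap)
  finally show ?thesis .
qed

text \<open>
  The state of the greedy sparsification of \<open>H\<close> after the breakpoints \<open>b en, \<dots>, b (tp - 1)\<close> have been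
  chosen. Besides the quality of the approximation up to the last breakpoint it records two bounds
  on the number of breakpoints: the values grow by a factor \<open>r\<close> and the breakpoints are distinct
  integers. The second one is what keeps the time linear in \<open>n\<close> for \<open>C = 1\<close>.
\<close>

definition greedy :: "(int \<Rightarrow> real) \<Rightarrow> real \<Rightarrow> int \<Rightarrow> (int \<Rightarrow> int) \<Rightarrow> (int \<Rightarrow> real) \<Rightarrow> int \<Rightarrow> int \<Rightarrow> real \<Rightarrow> bool"
  where
  "greedy H r C b w en tp v \<longleftrightarrow>
     en < tp \<and> b (tp - 1) \<le> C \<and> tp - en - 1 \<le> b (tp - 1) \<and> v = H (b (tp - 1)) \<and>
     r ^ nat (tp - en - 1) * H 0 \<le> v \<and>
     (\<forall>j\<in>{en..<tp}. 0 \<le> b j \<and> b j \<le> b (tp - 1) \<and> 0 \<le> w j) \<and>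
     (\<Sum>j\<in>{en..<tp}. w j) = v \<and>
     (\<forall>y\<in>{0..C}. step_fun b w en tp y \<le> H y) \<and>
     (\<forall>y\<in>{0..b (tp - 1)}. H y \<le> r * step_fun b w en tp y) \<and>
     step_fun b w en tp 0 = H 0"

lemma greedy_level:
  assumes "greedy H r C b w en tp v" "b (tp - 1) \<le> z"
  shows "step_fun b w en tp z = v"
proof -
  have "b j \<le> z" if "j \<in> {en..<tp}" for j
    using assms that unfolding greedy_def by (meson order_trans)
  then have "step_fun b w en tp z = (\<Sum>j\<in>{en..<tp}. w j)"
    unfolding step_fun_def by (intro sum.cong) auto
  then show ?thesis using assms by (simp add: greedy_def)
qed

lemma greedy_init:
  assumes "mono H" "0 \<le> H 0" "1 \<le> r" "0 \<le> C" "b en = 0" "w en = H 0"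
  shows "greedy H r C b w en (en + 1) (H 0)"
proof -
  have "1 * H 0 \<le> r * H 0" using assms by (intro mult_right_mono) auto
  moreover have "{en..<en + 1} = {en}" by auto
  ultimately show ?thesis
    using assms by (auto simp: greedy_def step_fun_def monoD)
qed

text \<open>The new jump changes nothing before \<open>y\<close> and lifts the function to
  \<open>H y\<close> from there on. In the gap before \<open>y\<close> the level \<open>v\<close>
  suffices, because \<open>H\<close> is at most \<open>H (y - 1) \<le> r * v\<close> there. The
  crossing \<open>r * v < H y\<close> yields one more factor \<open>r\<close>.\<close>

lemma greedy_append:
  assumes g: "greedy H r C b w en tp v" and H: "mono H" "0 \<le> H 0" and r: "1 \<le> r"
    and y: "b (tp - 1) < y" "y \<le> C" "H (y - 1) \<le> r * v" "r * v < H y"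
  shows "greedy H r C (b(tp := y)) (w(tp := H y - v)) en (tp + 1) (H y)"
proof -
  define b' w' where "b' = b(tp := y)" and "w' = w(tp := H y - v)"
  have en: "en < tp" and last: "0 \<le> b (tp - 1)" and v: "v = H (b (tp - 1))"
    using g by (auto simp: greedy_def)
  have *: "{en..<tp + 1} = insert tp {en..<tp}"
    using en by (intro atLeastLessThan_plus1_int) simp
  have v_ge: "0 \<le> v" using monoD[OF H(1) last] H(2) v by simp
  have vy: "v \<le> H y" using y(1) v monoD[OF H(1), of "b (tp - 1)" y] by simp
  have total: "(\<Sum>j\<in>{en..<tp + 1}. w' j) = H y"
  proof -
    have "(\<Sum>j\<in>{en..<tp}. w' j) = (\<Sum>j\<in>{en..<tp}. w j)"
      by (rule sum.cong) (auto simp: w'_def)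
    then show ?thesis using g by (simp add: * greedy_def w'_def)
  qed
  have below: "step_fun b' w' en (tp + 1) z = step_fun b w en tp z" if "z < y" for z
  proof -
    have "(\<Sum>j\<in>{en..<tp}. if b' j \<le> z then w' j else 0) = step_fun b w en tp z"
      unfolding step_fun_def by (rule sum.cong) (auto simp: b'_def w'_def)
    with that show ?thesis by (simp add: step_fun_def * b'_def)
  qed
  have b'_le: "b' j \<le> y" if "j \<in> {en..<tp + 1}" for j
  proof (cases "j = tp")
    case False
    then have "b j \<le> b (tp - 1)" using g that unfolding greedy_def by simp
    then show ?thesis using False y(1) by (simp add: b'_def)
  qed (simp add: b'_def)
  have above: "step_fun b' w' en (tp + 1) z = H y" if "y \<le> z" for z
  proof -
    have "b' j \<le> z" if "j \<in> {en..<tp + 1}" for j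
      using b'_le[OF that] \<open>y \<le> z\<close> by simp
    then have "step_fun b' w' en (tp + 1) z = (\<Sum>j\<in>{en..<tp + 1}. w' j)"
      unfolding step_fun_def by (intro sum.cong) auto
    then show ?thesis using total by simp
  qed
  note level = greedy_level[OF g]
  have upper: "H z \<le> r * step_fun b' w' en (tp + 1) z" if "z \<in> {0..y}" for z
  proof -
    consider "z \<le> b (tp - 1)" | "b (tp - 1) < z" "z < y" | "z = y" using \<open>z \<in> {0..y}\<close> by fastforce
    then show ?thesis
    proof cases
      case 1
      then show ?thesis using g y(1) that below[of z] by (auto simp: greedy_def)
    next
      case 2
      then have "H z \<le> H (y - 1)" using monoD[OF H(1)] by simp
      then show ?thesis using y(3) below[OF 2(2)] level[of z] 2 by simp
    next
      case 3
      have "1 * H y \<le> r * H y" using r vy v_ge by (intro mult_right_mono) auto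
      then show ?thesis using above 3 by simp
    qed
  qed
  have lower: "step_fun b' w' en (tp + 1) z \<le> H z" if "z \<in> {0..C}" for z
    using that g below[of z] above[of z] monoD[OF H(1), of y z]
    by (cases "z < y") (auto simp: greedy_def)
  have pow: "r ^ nat (tp + 1 - en - 1) * H 0 \<le> H y"
  proof -
    have "nat (tp + 1 - en - 1) = Suc (nat (tp - en - 1))" using en by simp
    then have "r ^ nat (tp + 1 - en - 1) * H 0 = r * (r ^ nat (tp - en - 1) * H 0)"
      by simp
    also have "\<dots> \<le> r * v" using g r by (intro mult_left_mono) (auto simp: greedy_def)
    finally show ?thesis using y(4) by simp
  qed
  have "greedy H r C b' w' en (tp + 1) (H y)"
    unfolding greedy_def
    using total lower upper pow below[of 0] g y vy last b'_le
    by (auto simp: greedy_def b'_def w'_def)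
  then show ?thesis by (simp add: b'_def w'_def)
qed

text \<open>Once \<open>H C \<le> r * v\<close>, monotonicity makes the last level good enough on
  the whole tail up to \<open>C\<close>.\<close>

lemma greedy_final:
  assumes g: "greedy H r C b w en tp v" and H: "mono H" and le: "H C \<le> r * v"
  shows "\<And>y. y \<in> {0..C} \<Longrightarrow> H y \<le> r * step_fun b w en tp y" and "step_fun b w en tp C = v"
proof -
  note level = greedy_level[OF g]
  then show "step_fun b w en tp C = v" using g by (auto simp: greedy_def)
  show "H y \<le> r * step_fun b w en tp y" if "y \<in> {0..C}" for y
    using g level[of y] le that monoD[OF H, of y C]
    by (cases "y \<le> b (tp - 1)") (auto simp: greedy_def)
qed

section \<open>Correctness and running time of the layer construction\<close>

text \<open>\<open>N\<close> bounds the number of breakpoints of a layer and \<open>g\<close> the number of bisection steps.\<close>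

locale layered =
  fixes Orc :: oracle_fun and n C N g :: nat and p F :: "nat \<Rightarrow> int \<Rightarrow> real" and r \<Delta> :: real
  assumes p_nonneg: "\<And>i k. 0 \<le> p i k"
    and Orc_eq: "1 \<le> i \<Longrightarrow> i \<le> n \<Longrightarrow> Orc (int i) 0 y = (\<Sum>k\<in>{0..y}. p i k)"
    and F_0: "0 \<le> y \<Longrightarrow> F 0 y = 1"
    and F_Suc: "i < n \<Longrightarrow> 0 \<le> x \<Longrightarrow> F (Suc i) x = (\<Sum>k\<in>{0..x}. p (Suc i) k * F i (x - k))"
    and F_le_1: "F i x \<le> 1"
    and F_zero: "i \<le> n \<Longrightarrow> \<Delta> \<le> F i 0"
    and \<Delta>_pos: "0 < \<Delta>"
    and r_ge_1: "1 \<le> r"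
    and N_pos: "1 \<le> N"
    and N_bound: "r ^ k * \<Delta> < 1 \<Longrightarrow> k \<le> C \<Longrightarrow> k < N"
    and C_le: "C \<le> 2 ^ g"
begin

text \<open>Exactness at 0 keeps the starting value of every sparsification at least
  \<open>\<Delta>\<close>, which bounds the number of breakpoints.\<close>

definition approx_layer :: "nat \<Rightarrow> (int \<Rightarrow> int) \<Rightarrow> (int \<Rightarrow> real) \<Rightarrow> int \<Rightarrow> int \<Rightarrow> bool" where
  "approx_layer i b w st en \<longleftrightarrow>
     st \<le> en \<and> en - st \<le> int N \<and> (\<forall>j\<in>{st..<en}. 0 \<le> b j \<and> 0 \<le> w j) \<and>
     (\<forall>y\<in>{0..int C}. step_fun b w st en y \<le> F i y \<and> F i y \<le> r ^ i * step_fun b w st en y) \<and>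
     step_fun b w st en 0 = F i 0"

text \<open>The weights \<open>p\<close> are nonnegative, so pointwise inequalities survive
  convolution with the same factor \<open>r ^ i\<close>. At 0 only the term \<open>k = 0\<close>
  remains, which preserves exactness.\<close>

lemma conv_approx_layer:
  fixes i b w st en
  defines "H \<equiv> conv (Orc (int (Suc i)) 0) b w st en"
  assumes L: "approx_layer i b w st en" and i: "i < n"
  shows "mono H" "H 0 = F (Suc i) 0"
    and "\<And>x. x \<in> {0..int C} \<Longrightarrow> H x \<le> F (Suc i) x \<and> F (Suc i) x \<le> r ^ i * H x"
proof -
  let ?q = "Orc (int (Suc i)) 0"
  have q: "?q y = (\<Sum>k\<in>{0..y}. p (Suc i) k)" for y
    using i by (intro Orc_eq) auto
  show "mono H"
  proof (rule monoI)
    fix x y :: int assume "x \<le> y"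
    have "?q (x - b j) \<le> ?q (y - b j)" for j
      unfolding q using \<open>x \<le> y\<close> by (intro sum_mono2) (auto simp: p_nonneg)
    then show "H x \<le> H y"
      unfolding H_def conv_def using L by (intro sum_mono mult_left_mono) (auto simp: approx_layer_def)
  qed
  have H: "H x = (\<Sum>k\<in>{0..x}. p (Suc i) k * step_fun b w st en (x - k))" for x
    unfolding H_def using L by (intro conv_eq_step_fun q) (auto simp: approx_layer_def)
  show "H 0 = F (Suc i) 0"
    using L i by (simp add: H F_Suc approx_layer_def)
  fix x assume x: "x \<in> {0..int C}"
  have "F i (x - k) \<le> r ^ i * step_fun b w st en (x - k)" "step_fun b w st en (x - k) \<le> F i (x - k)"
    if "k \<in> {0..x}" for k
    using L x that by (auto simp: approx_layer_def)
  then show "H x \<le> F (Suc i) x \<and> F (Suc i) x \<le> r ^ i * H x"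
    using x i unfolding H by (auto simp: F_Suc sum_distrib_left mult.left_commute[of "r ^ i"] p_nonneg
        intro!: sum_mono mult_left_mono)
qed

text \<open>Convolution loses no accuracy and sparsification loses one factor
  \<open>r\<close>.\<close>

lemma approx_layer_greedy:
  fixes i b w st en
  defines "H \<equiv> conv (Orc (int (Suc i)) 0) b w st en"
  assumes L: "approx_layer i b w st en" and i: "i < n"
    and g: "greedy H r (int C) b' w' en tp v" and le: "H (int C) \<le> r * v" and N: "tp - en \<le> int N"
  shows "approx_layer (Suc i) b' w' en tp" "step_fun b' w' en tp (int C) = v"
proof -
  note H = conv_approx_layer[OF L i, folded H_def]
  note f = greedy_final[OF g H(1) le]
  have "step_fun b' w' en tp y \<le> F (Suc i) y \<and> F (Suc i) y \<le> r ^ Suc i * step_fun b' w' en tp y"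
    if y: "y \<in> {0..int C}" for y
  proof -
    have "F (Suc i) y \<le> r ^ i * H y" using H(3)[OF y] by simp
    also have "\<dots> \<le> r ^ i * (r * step_fun b' w' en tp y)"
      using f(1)[OF y] r_ge_1 by (intro mult_left_mono) auto
    finally have "F (Suc i) y \<le> r ^ Suc i * step_fun b' w' en tp y" by (simp add: mult_ac)
    moreover have "step_fun b' w' en tp y \<le> H y" using g y by (auto simp: greedy_def)
    ultimately show ?thesis using H(3)[OF y] by linarith
  qed
  then show "approx_layer (Suc i) b' w' en tp"
    using g N H(2) by (auto simp: approx_layer_def greedy_def)
  show "step_fun b' w' en tp (int C) = v" by (rule f(2))
qed

text \<open>The old layer is frozen in the cells below \<open>en\<close> while the new one is
  appended. The counter has already been incremented, hence \<open>Suc i\<close>.\<close>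

definition building :: "nat \<Rightarrow> (int \<Rightarrow> int) \<Rightarrow> (int \<Rightarrow> real) \<Rightarrow> int \<Rightarrow> int \<Rightarrow> state \<Rightarrow> bool" where
  "building i b w st en s \<longleftrightarrow>
     ints s ''st'' 0 = st \<and> ints s ''en'' 0 = en \<and> ints s ''i'' 0 = int (Suc i) \<and>
     ints s ''n'' 0 = int n \<and> ints s ''C'' 0 = int C \<and> reals s ''r'' 0 = r \<and>
     (\<forall>j<en. ints s ''b'' j = b j \<and> reals s ''w'' j = w j)"

text \<open>Cells from \<open>en\<close> on do not enter the sum, so all evaluations during the
  construction compute the same function.\<close>

lemma building_conv:
  assumes "building i b w st en s"
  shows "conv (Orc (ints s ''i'' 0) 0) (ints s ''b'') (reals s ''w'') (ints s ''st'' 0) (ints s ''en'' 0)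
    = conv (Orc (int (Suc i)) 0) b w st en"
  using assms by (auto simp: conv_def building_def fun_eq_iff intro!: sum.cong)

text \<open>Each round adds one breakpoint, so the free room \<open>N - (top - en)\<close> is the
  variant; the guard itself implies that there is room for one more.\<close>

lemma runs_extend_prog:
  fixes i b w st en
  defines "H \<equiv> conv (Orc (int (Suc i)) 0) b w st en"
  defines "J \<equiv> \<lambda>s. building i b w st en s \<and> reals s ''hC'' 0 = H (int C) \<and>
    ints s ''top'' 0 - en \<le> int N \<and>
    greedy H r (int C) (ints s ''b'') (reals s ''w'') en (ints s ''top'' 0) (reals s ''v'' 0)"
  assumes L: "approx_layer i b w st en" and i: "i < n" and s: "J s"
  shows "runs Orc extend_prog s (\<lambda>t s'. t \<le> N * (300 * ((g + 1) * (N + 1))) \<and> J s' \<and>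
     H (int C) \<le> r * reals s' ''v'' 0)"
proof -
  note H = conv_approx_layer[OF L i, folded H_def]
  let ?E = "(g + 1) * (N + 1)"
  have E: "N + 1 \<le> ?E" "1 \<le> ?E" by auto
  have st: "st \<le> en" "en - st \<le> int N" using L by (auto simp: approx_layer_def)
  define I where "I = (\<lambda>k s. J s \<and> int k = int N - (ints s ''top'' 0 - en))"
  have H0: "\<Delta> \<le> H 0" using H(2) F_zero[of "Suc i"] i by simp
  have step: "runs Orc
      (Seq (iset ''lo'' (IArr ''b'' (ISub (ivar ''top'') (IConst 1))))
      (Seq (iset ''hi'' (ivar ''C''))
      (Seq search_prog
      (Seq (iset ''x'' (ivar ''hi''))
      (Seq eval_prog append_prog))))) s
      (\<lambda>t s'. t \<le> 200 * ?E \<and> (\<exists>k'<k. I k' s'))"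
    if I: "I k s" and b: "bval Orc s (RLess (RMul (rvar ''r'') (rvar ''v'')) (rvar ''hC''))" for k s
  proof -
    define tp bs ws v where "tp = ints s ''top'' 0" and "bs = ints s ''b''" and "ws = reals s ''w''"
      and "v = reals s ''v'' 0"
    have g: "greedy H r (int C) bs ws en tp v" and bu: "building i b w st en s"
      using I by (auto simp: I_def J_def tp_def bs_def ws_def v_def)
    have HC: "r * v < H (int C)" using b I by (simp add: I_def J_def building_def v_def)
    define last where "last = bs (tp - 1)"
    have last: "last \<le> int C" "v = H last" "tp - en - 1 \<le> last" "en < tp"
      using g by (auto simp: greedy_def last_def)
    have "0 < v"
    proof -
      have "\<Delta> \<le> r ^ nat (tp - en - 1) * H 0"
        using H0 \<Delta>_pos mult_mono[of 1 "r ^ nat (tp - en - 1)" \<Delta> "H 0"] r_ge_1 by simp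
      then show ?thesis using g \<Delta>_pos by (auto simp: greedy_def)
    qed
    then have "v \<le> r * v" using r_ge_1 by simp
    \<comment> \<open>A last breakpoint at \<open>C\<close> would give \<open>v = H C\<close>,
      against the guard.\<close>
    with HC have "last \<noteq> int C" using last by auto
    with last have lt: "last < int C" by simp
    define m where "m = nat (tp - en)"
    have m: "int m = tp - en" "m = Suc (nat (tp - en - 1))" using last by (auto simp: m_def)
    \<comment> \<open>The \<open>m\<close> breakpoints account for \<open>m - 1\<close> factors
      \<open>r\<close> and the guard for another, so \<open>r ^ m * \<Delta> < H C \<le> 1\<close>.
      Distinctness of the breakpoints and \<open>last < C\<close> give
      \<open>m \<le> C\<close>.\<close>
    have "r ^ m * \<Delta> \<le> r ^ m * H 0"
      using H0 r_ge_1 by (intro mult_left_mono) auto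
    also have "\<dots> = r * (r ^ nat (tp - en - 1) * H 0)" using m by simp
    also have "\<dots> \<le> r * v" using g r_ge_1 by (intro mult_left_mono) (auto simp: greedy_def)
    also have "\<dots> < H (int C)" by (rule HC)
    also have "\<dots> \<le> 1" using H(3)[of "int C"] F_le_1[of "Suc i" "int C"] by simp
    finally have "m < N" using m last lt by (intro N_bound) auto
    then have tpN: "tp + 1 - en \<le> int N" using m by simp
    define s1 where "s1 = iwrite ''hi'' 0 (int C) (iwrite ''lo'' 0 last s)"
    have bu1: "building i b w st en s1" using bu by (auto simp: building_def s1_def)
    have "int C \<le> 2 ^ g" using C_le by (metis of_nat_le_iff of_nat_numeral of_nat_power)
    moreover have "0 \<le> last" using last by simp
    ultimately have "int C - last \<le> 2 ^ g" by linarith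
    then have R1: "runs Orc search_prog s1 (\<lambda>t s'. t \<le> 80 * ?E \<and>
       same_except {''lo'', ''hi'', ''x'', ''j''} {''h''} s1 s' \<and>
       last < ints s' ''hi'' 0 \<and> ints s' ''hi'' 0 \<le> int C \<and>
       H (ints s' ''hi'' 0 - 1) \<le> r * v \<and> r * v < H (ints s' ''hi'' 0))"
      using runs_search_prog[of s1 N g Orc] bu st lt HC last \<open>v \<le> r * v\<close>
      unfolding building_conv[OF bu1, folded H_def]
      by (simp add: s1_def building_def v_def)
    show ?thesis
      using bu apply (simp add: building_def)
      apply (simp add: tp_def[symmetric] bs_def[symmetric] last_def[symmetric] s1_def[symmetric])
    proof (rule runs_mono[OF R1], goal_cases)
      case (1 t1 s2)
      then have t1: "t1 \<le> 80 * ?E" by blast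
      define y where "y = ints s2 ''hi'' 0"
      define s3 where "s3 = iwrite ''x'' 0 y s2"
      have se: "same_except {''lo'', ''hi'', ''x'', ''j''} {''h''} s s3"
        using 1 by (auto simp: same_except_def s1_def s3_def)
      have bu3: "building i b w st en s3" using bu se by (auto simp: building_def same_except_def)
      have R3: "runs Orc eval_prog s3 (\<lambda>t s'. t \<le> 40 * (N + 1) \<and>
         same_except {''j''} {''h''} s3 s' \<and> reals s' ''h'' 0 = H y)"
        using runs_eval_prog[of s3 N Orc] bu3 st
        unfolding building_conv[OF bu3, folded H_def]
        by (simp add: s3_def building_def)
      have g': "greedy H r (int C) (bs(tp := y)) (ws(tp := H y - v)) en (tp + 1) (H y)"
        using g H(1) H0 \<Delta>_pos r_ge_1 1 by (intro greedy_append) (auto simp: last_def y_def)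
      show ?case
        unfolding y_def[symmetric] s3_def[symmetric]
      proof (rule runs_mono[OF R3], goal_cases)
        case (1 t2 s4)
        have se4: "same_except {''lo'', ''hi'', ''x'', ''j''} {''h''} s s4"
          using 1 se by (auto simp: same_except_def)
        have x4: "ints s4 ''x'' 0 = y" using 1 by (auto simp: same_except_def s3_def)
        \<comment> \<open>Abstracting the product to \<open>e\<close> makes the estimate
          linear.\<close>
        have "t1 + t2 + 60 \<le> 200 * e" if "t1 \<le> 80 * e" "N + 1 \<le> e" for e :: nat
          using that conjunct1[OF 1] by simp
        note t = this[OF t1 E(1)]
        define s5 where "s5 = iwrite ''top'' 0 (tp + 1) (rwrite ''v'' 0 (H y)
          (rwrite ''w'' tp (H y - v) (iwrite ''b'' tp y s4)))"
        have old: "ints s4 ''top'' 0 = tp" "reals s4 ''v'' 0 = v" "ints s4 ''b'' = bs" "reals s4 ''w'' = ws"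
          using se4 by (simp_all add: same_except_def tp_def v_def bs_def ws_def)
        \<comment> \<open>23 is the exact cost of the four assignments.\<close>
        have app: "runs Orc append_prog s4 Q \<longleftrightarrow> Q 23 s5" for Q
          using 1 old x4 by (simp add: append_prog_def s5_def eval_nat_numeral)
        have "building i b w st en s5"
          using bu se4 last(4) by (simp add: building_def same_except_def s5_def)
        moreover have "reals s5 ''hC'' 0 = H (int C)"
          using I se4 by (simp add: I_def J_def same_except_def s5_def)
        ultimately have "J s5"
          using g' tpN old by (simp add: J_def s5_def)
        moreover have "int k = int N - (tp - en)" using I by (simp add: I_def tp_def)
        ultimately have "I (k - 1) s5" "k - 1 < k"
          using tpN by (auto simp: I_def s5_def)
        then show ?case
          unfolding app using t by (auto simp: algebra_simps)
      qed
    qed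
  qed
  show ?thesis
    unfolding extend_prog_def
    apply (rule runs_mono)
     apply (rule runs_While[where I = I and k = "nat (int N - (ints s ''top'' 0 - en))", OF step])
       apply assumption
      apply assumption
    subgoal using s by (simp add: I_def J_def)
    subgoal premises prems for t s'
    proof -
      have "en < ints s ''top'' 0" using s by (simp add: J_def greedy_def)
      then have "nat (int N - (ints s ''top'' 0 - en)) + 1 \<le> N" using N_pos s by (auto simp: J_def)
      moreover have "1 + bcost (RLess (RMul (rvar ''r'') (rvar ''v'')) (rvar ''hC'')) + 200 * ?E \<le> 300 * ?E"
        using E(2) by simp
      ultimately have "t \<le> N * (300 * ?E)" using prems by (meson mult_le_mono order_trans)
      then show ?thesis using prems by (auto simp: I_def J_def building_def)
    qed
    done
qed

text \<open>The value at \<open>C\<close> is the level after the last breakpoint, which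
  \<open>v\<close> holds only once a layer has been built. After layer \<open>n\<close> it is the
  answer.\<close>

definition ready :: "nat \<Rightarrow> state \<Rightarrow> bool" where
  "ready i s \<longleftrightarrow> ints s ''i'' 0 = int i \<and> ints s ''n'' 0 = int n \<and> ints s ''C'' 0 = int C \<and>
     reals s ''r'' 0 = r \<and>
     approx_layer i (ints s ''b'') (reals s ''w'') (ints s ''st'' 0) (ints s ''en'' 0) \<and>
     (0 < i \<longrightarrow> reals s ''v'' 0 =
        step_fun (ints s ''b'') (reals s ''w'') (ints s ''st'' 0) (ints s ''en'' 0) (int C))"

lemma runs_layer_prog:
  assumes s: "ready i s" and i: "i < n"
  shows "runs Orc layer_prog s (\<lambda>t s'. t \<le> 600 * ((N + 1) * ((g + 1) * (N + 1))) \<and> ready (Suc i) s')"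
proof -
  define st en b w where "st = ints s ''st'' 0" and "en = ints s ''en'' 0"
    and "b = ints s ''b''" and "w = reals s ''w''"
  define H where "H = conv (Orc (int (Suc i)) 0) b w st en"
  have L: "approx_layer i b w st en" using s by (simp add: ready_def st_def en_def b_def w_def)
  note H = conv_approx_layer[OF L i, folded H_def]
  have st: "st \<le> en" "en - st \<le> int N" using L by (auto simp: approx_layer_def)
  have H0: "\<Delta> \<le> H 0" using H(2) F_zero[of "Suc i"] i by simp
  let ?E = "(g + 1) * (N + 1)"
  have E: "N + 1 \<le> ?E" "1 \<le> ?E" by auto
  have E2: "(N + 1) * ?E = N * ?E + ?E" by (simp add: algebra_simps)
  define s1 where "s1 = iwrite ''x'' 0 (int C) (iwrite ''top'' 0 en (iwrite ''i'' 0 (int (Suc i)) s))"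
  have bu1: "building i b w st en s1"
    using s by (auto simp: s1_def building_def ready_def st_def en_def b_def w_def)
  have R1: "runs Orc eval_prog s1 (\<lambda>t s'. t \<le> 40 * (N + 1) \<and>
      same_except {''j''} {''h''} s1 s' \<and> reals s' ''h'' 0 = H (int C))"
    using runs_eval_prog[of s1 N Orc] bu1 st
    unfolding building_conv[OF bu1, folded H_def]
    by (simp add: s1_def building_def)
  have pre: "iwrite ''x'' 0 (ints s ''C'' 0) (iwrite ''top'' 0 (ints s ''en'' 0)
      (iwrite ''i'' 0 (ints s ''i'' 0 + 1) s)) = s1"
    using s by (simp add: s1_def ready_def en_def add.commute)
  show ?thesis
    unfolding layer_prog_def
    apply (simp add: pre)
  proof (rule runs_mono[OF R1], goal_cases)
    case (1 t1 s2)
    then have t1: "t1 \<le> 40 * (N + 1)" by blast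
    define s3 where "s3 = iwrite ''x'' 0 0 (rwrite ''hC'' 0 (H (int C)) s2)"
    have se3: "same_except {''j'', ''x'', ''top'', ''i''} {''h'', ''hC''} s s3"
      using 1 by (auto simp: same_except_def s1_def s3_def)
    have bu3: "building i b w st en s3" and hC3: "reals s3 ''hC'' 0 = H (int C)"
      and top3: "ints s3 ''top'' 0 = en" and x3: "ints s3 ''x'' 0 = 0"
      using bu1 1 by (auto simp: building_def same_except_def s3_def s1_def)
    have R3: "runs Orc eval_prog s3 (\<lambda>t s'. t \<le> 40 * (N + 1) \<and>
      same_except {''j''} {''h''} s3 s' \<and> reals s' ''h'' 0 = H 0)"
      using runs_eval_prog[of s3 N Orc] bu3 st
      unfolding building_conv[OF bu3, folded H_def]
      by (simp add: s3_def building_def)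
    have pre: "iwrite ''x'' 0 0 (rwrite ''hC'' 0 (reals s2 ''h'' 0) s2) = s3"
      using 1 by (simp add: s3_def)
    show ?case
      unfolding pre
    proof (rule runs_mono[OF R3], goal_cases)
      case (1 t2 s4)
      then have t2: "t2 \<le> 40 * (N + 1)" by blast
      \<comment> \<open>With \<open>v\<close> reset to 0 and \<open>x = 0\<close>, the append
        records breakpoint 0 with the full height \<open>H 0\<close>.\<close>
      define s5 where "s5 = iwrite ''top'' 0 (en + 1) (rwrite ''v'' 0 (H 0)
        (rwrite ''w'' en (H 0) (iwrite ''b'' en 0 (rwrite ''v'' 0 0 s4))))"
      have "greedy H r (int C) (ints s5 ''b'') (reals s5 ''w'') en (en + 1) (H 0)"
        using H(1) H0 \<Delta>_pos r_ge_1 by (intro greedy_init) (auto simp: s5_def)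
      moreover have "building i b w st en s5"
        using bu3 1 by (auto simp: building_def same_except_def s5_def)
      ultimately have R5: "runs Orc extend_prog s5
         (\<lambda>t s'. t \<le> N * (300 * ?E) \<and> (building i b w st en s' \<and> reals s' ''hC'' 0 = H (int C) \<and>
            ints s' ''top'' 0 - en \<le> int N \<and>
            greedy H r (int C) (ints s' ''b'') (reals s' ''w'') en (ints s' ''top'' 0) (reals s' ''v'' 0)) \<and>
          H (int C) \<le> r * reals s' ''v'' 0)"
        unfolding H_def using 1 N_pos hC3 by (intro runs_extend_prog L i)
          (auto simp: s5_def same_except_def H_def)
      have pre: "runs Orc append_prog (rwrite ''v'' 0 0 s4) Q \<longleftrightarrow> Q 23 s5" for Q
        using 1 top3 x3 by (simp add: append_prog_def s5_def same_except_def eval_nat_numeral)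
      show ?case
        apply (simp add: pre)
      proof (rule runs_mono[OF R5], goal_cases)
        case (1 t3 s6)
        then have t3: "t3 \<le> N * (300 * ?E)" by blast
        have "approx_layer (Suc i) (ints s6 ''b'') (reals s6 ''w'') en (ints s6 ''top'' 0)"
          and "step_fun (ints s6 ''b'') (reals s6 ''w'') en (ints s6 ''top'' 0) (int C) = reals s6 ''v'' 0"
          using 1 L i by (auto intro!: approx_layer_greedy simp: H_def)
        moreover have "t1 + t2 + t3 + 100 \<le> 600 * (a + e)"
          if "t3 \<le> 300 * a" "N + 1 \<le> e" for a e :: nat
          using that t1 t2 by simp
        from this[of "N * ?E" ?E] have "t1 + t2 + t3 + 100 \<le> 600 * ((N + 1) * ?E)"
          using t3 E unfolding E2 by (simp only: mult.left_commute)
        ultimately show ?case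
          using 1 by (auto simp: ready_def building_def)
      qed
    qed
  qed
qed

lemma runs_layers_loop:
  assumes s: "ready 0 s"
  shows "runs Orc (While (ILess (ivar ''i'') (ivar ''n'')) layer_prog) s
    (\<lambda>t s'. t \<le> (n + 1) * (700 * ((N + 1) * ((g + 1) * (N + 1)))) \<and> ready n s')"
proof -
  let ?A = "(N + 1) * ((g + 1) * (N + 1))"
  define I where "I = (\<lambda>k s. k \<le> n \<and> ready (n - k) s)"
  show ?thesis
    apply (rule runs_mono)
     apply (rule runs_While[where I = I and k = n and T = "600 * ?A"])
    subgoal premises prems for k s
    proof -
      have k: "k \<le> n" "ready (n - k) s" using prems by (auto simp: I_def)
      then have "0 < k" using prems(2) by (auto simp: ready_def)
      show ?thesis
        by (rule runs_mono[OF runs_layer_prog[OF k(2)]])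
          (use \<open>0 < k\<close> k in \<open>auto simp: I_def Suc_diff_le intro!: exI[of _ "k - 1"]\<close>)
    qed
    subgoal using s by (simp add: I_def)
    subgoal premises prems for t s'
    proof -
      obtain k where k: "k \<le> n" "ready (n - k) s'" using prems by (auto simp: I_def)
      with prems have "k = 0" by (auto simp: ready_def)
      moreover have "1 \<le> ?A" by simp
      then have "1 + bcost (ILess (ivar ''i'') (ivar ''n'')) + 600 * ?A \<le> 700 * ?A" by simp
      then have "(n + 1) * (1 + bcost (ILess (ivar ''i'') (ivar ''n'')) + 600 * ?A) \<le> (n + 1) * (700 * ?A)"
        by (rule mult_le_mono2)
      with prems have "t \<le> (n + 1) * (700 * ?A)" by (blast intro: order_trans)
      ultimately show ?thesis using k by simp
    qed
    done
qed

end

section \<open>Computing the probability that all variables vanish\<close>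

lemma runs_zero_prog:
  assumes "ints s ''i'' 0 = 0" "ints s ''n'' 0 = int n"
  shows "runs Orc zero_prog s (\<lambda>t s'. t \<le> 30 * (n + 1) \<and> same_except {''i''} {''d''} s s' \<and>
    reals s' ''d'' 0 = (\<Prod>i = 1..n. Orc (int i) 0 0))"
proof -
  define I where "I = (\<lambda>k s'. k \<le> n \<and> same_except {''i''} {''d''} s s' \<and> ints s' ''i'' 0 = int (n - k) \<and>
    reals s' ''d'' 0 = (\<Prod>i = 1..n - k. Orc (int i) 0 0))"
  show ?thesis
    unfolding zero_prog_def runs_Seq runs_RAssign
    apply (rule runs_mono)
     apply (rule runs_While[where I = I and k = n and T = 20])
    subgoal premises prems for k s'
    proof -
      have n: "ints s' ''n'' 0 = int n" using prems(1) assms by (simp add: I_def same_except_def)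
      with prems have "0 < k" by (auto simp: I_def)
      then have k: "n - (k - 1) = Suc (n - k)" using prems by (auto simp: I_def)
      show ?thesis
        using prems n \<open>0 < k\<close> k
        by (auto simp: I_def same_except_def add.commute intro!: exI[of _ "k - 1"])
    qed
    subgoal using assms by (auto simp: I_def same_except_def)
    subgoal premises prems for t s'
    proof -
      obtain k where k: "I k s'" using prems by blast
      then have "k = 0" using prems assms by (auto simp: I_def same_except_def)
      then show ?thesis using prems k by (auto simp: I_def)
    qed
    done
qed

section \<open>The distribution of the partial sums\<close>

context prob_space
begin

lemma measurable_count_sets:
  "X \<in> M \<rightarrow>\<^sub>M count_space UNIV \<Longrightarrow> {\<omega> \<in> space M. P (X \<omega>)} \<in> events"
proof -
  assume "X \<in> M \<rightarrow>\<^sub>M count_space UNIV"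
  then have "X -` {x. P x} \<inter> space M \<in> events" by (rule measurable_sets) simp
  also have "X -` {x. P x} \<inter> space M = {\<omega> \<in> space M. P (X \<omega>)}" by auto
  finally show ?thesis .
qed

text \<open>Split by the value of \<open>Z\<close>: the events are disjoint, and each factorises by
  independence. As \<open>Y\<close> is nonnegative, \<open>Z\<close> cannot exceed
  \<open>x\<close>.\<close>

lemma prob_convolution:
  fixes Y Z :: "'a \<Rightarrow> nat"
  assumes "indep_var (count_space UNIV) Y (count_space UNIV) Z" "0 \<le> x"
  shows "prob {\<omega> \<in> space M. int (Y \<omega> + Z \<omega>) \<le> x} =
    (\<Sum>k\<in>{0..x}. prob {\<omega> \<in> space M. int (Z \<omega>) = k} * prob {\<omega> \<in> space M. int (Y \<omega>) \<le> x - k})"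
proof -
  have m: "Y \<in> M \<rightarrow>\<^sub>M count_space UNIV" "Z \<in> M \<rightarrow>\<^sub>M count_space UNIV"
    using assms indep_var_rv1 indep_var_rv2 by blast+
  define A where "A = (\<lambda>k. {\<omega> \<in> space M. int (Y \<omega>) \<le> x - k \<and> int (Z \<omega>) = k})"
  have A: "A k \<in> events" for k
    unfolding A_def using m by (intro sets.sets_Collect_conj measurable_count_sets)
  have "{\<omega> \<in> space M. int (Y \<omega> + Z \<omega>) \<le> x} = (\<Union>k\<in>{0..x}. A k)"
    unfolding A_def by auto
  also have "prob \<dots> = (\<Sum>k\<in>{0..x}. prob (A k))"
    using A by (intro finite_measure_finite_Union) (auto simp: disjoint_family_on_def A_def)
  also have "\<dots> = (\<Sum>k\<in>{0..x}. prob {\<omega> \<in> space M. int (Z \<omega>) = k} * prob {\<omega> \<in> space M. int (Y \<omega>) \<le> x - k})"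
  proof (rule sum.cong[OF refl])
    fix k
    have "prob ((\<lambda>\<omega>. (Y \<omega>, Z \<omega>)) -` ({y. int y \<le> x - k} \<times> {z. int z = k}) \<inter> space M) =
      prob (Y -` {y. int y \<le> x - k} \<inter> space M) * prob (Z -` {z. int z = k} \<inter> space M)"
      using assms by (intro indep_varD) auto
    moreover have "(\<lambda>\<omega>. (Y \<omega>, Z \<omega>)) -` ({y. int y \<le> x - k} \<times> {z. int z = k}) \<inter> space M = A k"
      and "Y -` {y. int y \<le> x - k} \<inter> space M = {\<omega> \<in> space M. int (Y \<omega>) \<le> x - k}"
      and "Z -` {z. int z = k} \<inter> space M = {\<omega> \<in> space M. int (Z \<omega>) = k}"
      by (auto simp: A_def)
    ultimately show "prob (A k) =
        prob {\<omega> \<in> space M. int (Z \<omega>) = k} * prob {\<omega> \<in> space M. int (Y \<omega>) \<le> x - k}"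
      by simp
  qed
  finally show ?thesis .
qed

lemma prob_le_eq_sum:
  fixes Z :: "'a \<Rightarrow> nat"
  assumes "Z \<in> M \<rightarrow>\<^sub>M count_space UNIV"
  shows "prob {\<omega> \<in> space M. 0 \<le> int (Z \<omega>) \<and> int (Z \<omega>) \<le> y} =
    (\<Sum>k\<in>{0..y}. prob {\<omega> \<in> space M. int (Z \<omega>) = k})"
proof -
  have "{\<omega> \<in> space M. 0 \<le> int (Z \<omega>) \<and> int (Z \<omega>) \<le> y} = (\<Union>k\<in>{0..y}. {\<omega> \<in> space M. int (Z \<omega>) = k})"
    by auto
  moreover have "{\<omega> \<in> space M. int (Z \<omega>) = k} \<in> events" for k
    using assms by (intro measurable_count_sets)
  ultimately show ?thesis
    by (auto simp: disjoint_family_on_def intro!: finite_measure_finite_Union)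
qed

text \<open>The two variables are functions of the disjoint blocks \<open>{1..i}\<close> and
  \<open>{Suc i}\<close>.\<close>

lemma indep_var_sum_nat:
  fixes X :: "nat \<Rightarrow> 'a \<Rightarrow> nat"
  assumes X: "indep_vars (\<lambda>_. count_space UNIV) X {1..n}" and i: "i < n"
  shows "indep_var (count_space UNIV) (\<lambda>\<omega>. \<Sum>j = 1..i. X j \<omega>) (count_space UNIV) (X (Suc i))"
proof -
  have "indep_var
      (count_space UNIV) ((\<lambda>f. \<Sum>j = 1..i. f j) \<circ> (\<lambda>\<omega>. restrict (\<lambda>j. X j \<omega>) {1..i}))
      (count_space UNIV) ((\<lambda>f. f (Suc i)) \<circ> (\<lambda>\<omega>. restrict (\<lambda>j. X j \<omega>) {Suc i}))"
  proof (rule indep_var_compose[OF indep_var_restrict[OF X]])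
    show "(\<lambda>f. \<Sum>j = 1..i. f j) \<in> Pi\<^sub>M {1..i} (\<lambda>_. count_space UNIV) \<rightarrow>\<^sub>M count_space (UNIV :: nat set)"
      by measurable
  qed (use i in auto)
  also have "(\<lambda>f. \<Sum>j = 1..i. f j) \<circ> (\<lambda>\<omega>. restrict (\<lambda>j. X j \<omega>) {1..i}) = (\<lambda>\<omega>. \<Sum>j = 1..i. X j \<omega>)"
    by (auto simp: fun_eq_iff intro!: sum.cong)
  also have "(\<lambda>f. f (Suc i)) \<circ> (\<lambda>\<omega>. restrict (\<lambda>j. X j \<omega>) {Suc i}) = X (Suc i)"
    by auto
  finally show ?thesis .
qed

definition point_prob :: "(nat \<Rightarrow> 'a \<Rightarrow> nat) \<Rightarrow> nat \<Rightarrow> int \<Rightarrow> real" where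
  "point_prob X i k = prob {\<omega> \<in> space M. int (X i \<omega>) = k}"

definition sum_cdf :: "(nat \<Rightarrow> 'a \<Rightarrow> nat) \<Rightarrow> nat \<Rightarrow> int \<Rightarrow> real" where
  "sum_cdf X i x = prob {\<omega> \<in> space M. int (\<Sum>j = 1..i. X j \<omega>) \<le> x}"

lemma sum_cdf_0: "0 \<le> y \<Longrightarrow> sum_cdf X 0 y = 1"
  by (simp add: sum_cdf_def prob_space)

lemma sum_cdf_le_1: "sum_cdf X i x \<le> 1"
  by (simp add: sum_cdf_def)

lemma point_prob_nonneg: "0 \<le> point_prob X i k"
  by (simp add: point_prob_def)

lemma sum_cdf_Suc:
  assumes "indep_vars (\<lambda>_. count_space UNIV) X {1..n}" "i < n" "0 \<le> x"
  shows "sum_cdf X (Suc i) x = (\<Sum>k\<in>{0..x}. point_prob X (Suc i) k * sum_cdf X i (x - k))"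
  using prob_convolution[OF indep_var_sum_nat[OF assms(1,2)] assms(3)]
  by (simp add: sum_cdf_def point_prob_def)

lemma indep_vars_measurable:
  "indep_vars (\<lambda>_. count_space UNIV) X {1..n} \<Longrightarrow> i \<in> {1..n} \<Longrightarrow> X i \<in> M \<rightarrow>\<^sub>M count_space UNIV"
  by (simp add: indep_vars_def)

lemma interval_oracle_eq_sum:
  assumes "indep_vars (\<lambda>_. count_space UNIV) X {1..n}" "i \<in> {1..n}"
  shows "interval_oracle M n X (int i) 0 y = (\<Sum>k\<in>{0..y}. point_prob X i k)"
  using prob_le_eq_sum[OF indep_vars_measurable[OF assms], of y] assms(2)
  by (simp add: interval_oracle_def point_prob_def)

lemma zero_prob_eq_prod: "zero_prob M n X = (\<Prod>i = 1..n. point_prob X i 0)"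
  by (simp add: zero_prob_def point_prob_def)

lemma sum_cdf_zero:
  assumes "indep_vars (\<lambda>_. count_space UNIV) X {1..n}" "i \<le> n"
  shows "sum_cdf X i 0 = (\<Prod>j = 1..i. point_prob X j 0)"
  using assms(2) by (induction i) (simp_all add: sum_cdf_0 sum_cdf_Suc[OF assms(1)])

text \<open>The factors of \<open>\<Delta>\<close> beyond the first \<open>i\<close> are at most
  1.\<close>

lemma zero_prob_le_sum_cdf:
  assumes "indep_vars (\<lambda>_. count_space UNIV) X {1..n}" "i \<le> n"
  shows "zero_prob M n X \<le> sum_cdf X i 0"
proof -
  have split: "{1..n} = {1..i} \<union> {Suc i..n}" using assms(2) by auto
  have "zero_prob M n X = sum_cdf X i 0 * (\<Prod>j = Suc i..n. point_prob X j 0)"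
    unfolding zero_prob_eq_prod sum_cdf_zero[OF assms] split by (rule prod.union_disjoint) auto
  also have "\<dots> \<le> sum_cdf X i 0 * 1"
    by (intro mult_left_mono prod_le_1) (auto simp: sum_cdf_def point_prob_def)
  finally show ?thesis by simp
qed

lemma zero_prob_pos:
  assumes "\<forall>i\<in>{1..n}. 0 \<in> supp M (X i)"
  shows "0 < zero_prob M n X"
  unfolding zero_prob_def using assms by (intro prod_pos) (auto simp: supp_def)

lemma sum_prob_eq_sum_cdf: "sum_prob M n X C = sum_cdf X n (int C)"
  unfolding sum_prob_def sum_cdf_def of_nat_le_iff ..

end

section \<open>Parameters and the theorem\<close>

lemma (in layered) runs_layers_prog:
  assumes s: "ints s ''n'' 0 = int n" "ints s ''C'' 0 = int C" "ints s ''st'' 0 = 0" "ints s ''b'' 0 = 0"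
    and r: "r = 1 + reals s ''eps'' 0 / (2 * real n)" and n: "1 \<le> n"
  shows "runs Orc layers_prog s (\<lambda>t s'. t \<le> 50 + (n + 1) * (700 * ((N + 1) * ((g + 1) * (N + 1)))) \<and>
    reals s' ''v'' 0 \<le> F n (int C) \<and> F n (int C) \<le> r ^ n * reals s' ''v'' 0)"
proof -
  define s1 where "s1 = iwrite ''i'' 0 0 (iwrite ''en'' 0 1 (rwrite ''w'' 0 1 (rwrite ''r'' 0 r s)))"
  have "{0..<1} = {0::int}" by auto
  \<comment> \<open>A single jump of height 1 at 0 represents \<open>F 0\<close> exactly on
    \<open>[0, C]\<close>.\<close>
  then have "ready 0 s1"
    using s N_pos F_0 by (auto simp: ready_def s1_def approx_layer_def step_fun_def)
  note R = runs_layers_loop[OF this]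
  have pre: "iwrite ''i'' 0 0 (iwrite ''en'' 0 1 (rwrite ''w'' 0 1
      (rwrite ''r'' 0 (1 + reals s ''eps'' 0 / (2 * real n)) s))) = s1"
    by (simp add: s1_def r)
  show ?thesis
    unfolding layers_prog_def
    apply (simp add: s pre)
    apply (rule runs_mono[OF R])
    using n by (auto simp: ready_def approx_layer_def algebra_simps)
qed

section \<open>Elementary estimates for the parameters\<close>

lemma power_one_plus_le:
  fixes \<epsilon> :: real
  assumes "0 < \<epsilon>" "\<epsilon> \<le> 1" "1 \<le> n"
  shows "(1 + \<epsilon> / (2 * real n)) ^ n \<le> 1 + \<epsilon>"
proof -
  have "(1 + \<epsilon> / (2 * real n)) ^ n \<le> exp (\<epsilon> / (2 * real n)) ^ n"
    using assms by (intro power_mono exp_ge_add_one_self) auto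
  also have "\<dots> = exp (\<epsilon> / 2)" using assms by (simp flip: exp_of_nat_mult)
  also have "\<dots> \<le> 1 + \<epsilon> / 2 + (\<epsilon> / 2)\<^sup>2" using assms by (intro exp_bound) auto
  also have "(\<epsilon> / 2)\<^sup>2 \<le> \<epsilon> / 2"
    using assms mult_left_mono[of "\<epsilon> / 2" 1 "\<epsilon> / 2"] by (simp add: power2_eq_square)
  finally show ?thesis by simp
qed

text \<open>In logarithms the condition reads \<open>k * ln r < ln (1 / \<Delta>)\<close>, and
  \<open>ln r \<ge> d - d\<^sup>2 \<ge> d / 2\<close> for
  \<open>d = r - 1 \<le> 1 / 2\<close>.\<close>

lemma breakpoint_bound:
  fixes \<epsilon> \<Delta> :: real
  assumes \<epsilon>: "0 < \<epsilon>" "\<epsilon> < 1" and n: "1 \<le> n" and \<Delta>: "0 < \<Delta>" "\<Delta> < 1 - \<epsilon>"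
  obtains N where "1 \<le> N" "real N \<le> 5 * real n * ln (1 / \<Delta>) / \<epsilon>"
    "\<And>k. (1 + \<epsilon> / (2 * real n)) ^ k * \<Delta> < 1 \<Longrightarrow> k < N"
proof -
  define L r where "L = ln (1 / \<Delta>)" and "r = 1 + \<epsilon> / (2 * real n)"
  have "ln \<Delta> \<le> \<Delta> - 1" using \<Delta> by (intro ln_le_minus_one)
  then have L: "\<epsilon> < L" using \<Delta> by (simp add: L_def ln_div)
  define d where "d = \<epsilon> / (2 * real n)"
  have d: "0 < d" "d \<le> 1 / 2" using \<epsilon> n by (auto simp: d_def field_simps)
  have "\<epsilon> / (4 * real n) = d / 2" by (simp add: d_def)
  also have "\<dots> \<le> d - d\<^sup>2"
    using mult_left_mono[of d "1 / 2" d] d by (simp add: power2_eq_square)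
  also have "\<dots> \<le> ln r"
    unfolding r_def d_def[symmetric] using d by (intro ln_one_plus_pos_lower_bound) auto
  finally have lnr: "\<epsilon> / (4 * real n) \<le> ln r" .
  define N where "N = nat \<lceil>4 * (real n * L / \<epsilon>)\<rceil>"
  \<comment> \<open>This lets the rounding in \<open>N\<close> be absorbed by raising the factor 4
    to 5.\<close>
  have q: "1 \<le> real n * L / \<epsilon>"
    using mult_mono[of 1 "real n" \<epsilon> L] L n \<epsilon> by (simp add: field_simps)
  have N: "4 * (real n * L / \<epsilon>) \<le> real N" "real N \<le> 4 * (real n * L / \<epsilon>) + 1"
    unfolding N_def using q by linarith+
  show thesis
  proof (rule that)
    have "1 \<le> real N" using N(1) q by linarith
    then show "1 \<le> N" by simp
    show "real N \<le> 5 * real n * ln (1 / \<Delta>) / \<epsilon>"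
    proof -
      have "real N \<le> 5 * x" if "real N \<le> 4 * x + 1" "1 \<le> x" for x
        using that by linarith
      from this[OF N(2) q] show ?thesis by (simp add: L_def)
    qed
    fix k assume k: "(1 + \<epsilon> / (2 * real n)) ^ k * \<Delta> < 1"
    show "k < N"
    proof (rule ccontr)
      assume "\<not> k < N"
      have r: "1 < r" using d by (simp add: r_def d_def)
      have "L = (4 * (real n * L / \<epsilon>)) * (\<epsilon> / (4 * real n))" using \<epsilon> n by simp
      also have "\<dots> \<le> real k * ln r"
        using lnr N(1) \<open>\<not> k < N\<close> d \<epsilon> by (intro mult_mono) auto
      finally have "exp L \<le> exp (real k * ln r)" by simp
      also have "exp (real k * ln r) = r ^ k" using r by (simp add: exp_of_nat_mult)
      also have "exp L = 1 / \<Delta>" using \<Delta> by (simp add: L_def)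
      finally show False using k \<Delta> by (simp add: r_def field_simps)
    qed
  qed
qed

text \<open>As \<open>log 2 C \<ge> 1\<close>, rounding up and adding 1 costs at most a factor 3;
  \<open>ln 2 \<ge> 1 / 2\<close> contributes the factor 2.\<close>

lemma search_bound:
  assumes "2 \<le> C"
  obtains g where "C \<le> 2 ^ g" "real g + 1 \<le> 6 * ln (real C)"
proof -
  define g where "g = nat \<lceil>log 2 (real C)\<rceil>"
  have l1: "1 \<le> log 2 (real C)" using assms by (simp add: le_log_iff)
  have g: "log 2 (real C) \<le> real g" "real g \<le> log 2 (real C) + 1"
    unfolding g_def using l1 by linarith+
  have "real C = 2 powr (log 2 (real C))" using assms by simp
  also have "\<dots> \<le> 2 powr (real g)" using g by (intro powr_mono) auto
  also have "\<dots> = real (2 ^ g)" by (simp add: powr_realpow)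
  finally have "C \<le> 2 ^ g" by (simp only: of_nat_le_iff)
  moreover have "1 / 2 \<le> ln (2::real)"
    using ln_le_minus_one[of "1 / 2 :: real"] by (simp add: ln_div)
  then have "log 2 (real C) * (1 / 2) \<le> ln (real C)"
    using l1 mult_left_mono[of "1 / 2" "ln (2::real)" "log 2 (real C)"] by (simp add: log_def)
  then have "real g + 1 \<le> 6 * ln (real C)" using g l1 by linarith
  ultimately show thesis by (rule that)
qed

text \<open>For \<open>C = 1\<close> the logarithmic term vanishes and only the bound
  \<open>n\<close> is available; there \<open>k \<le> C\<close> permits \<open>N = 2\<close>.
  Otherwise \<open>N + 1\<close> is bounded with the constant 10 and \<open>g + 1\<close> with 6,
  whence 600 = 10 * 10 * 6.\<close>

lemma layer_parameters:
  fixes \<epsilon> \<Delta> :: real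
  assumes \<epsilon>: "0 < \<epsilon>" "\<epsilon> < 1" and n: "1 \<le> n" and C: "1 \<le> C" and \<Delta>: "0 < \<Delta>" "\<Delta> < 1 - \<epsilon>"
  obtains N g where "1 \<le> N" "C \<le> 2 ^ g"
    "\<And>k. (1 + \<epsilon> / (2 * real n)) ^ k * \<Delta> < 1 \<Longrightarrow> k \<le> C \<Longrightarrow> k < N"
    "real (n * ((N + 1) * ((g + 1) * (N + 1)))) \<le> 600 * time_bound n C \<epsilon> \<Delta>"
proof (cases "C = 1")
  case True
  have "real n \<le> time_bound n C \<epsilon> \<Delta>" by (simp add: time_bound_def)
  with True show thesis by (intro that[of 2 0]) auto
next
  case False
  obtain N where N: "1 \<le> N" "real N \<le> 5 * real n * ln (1 / \<Delta>) / \<epsilon>"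
    "\<And>k. (1 + \<epsilon> / (2 * real n)) ^ k * \<Delta> < 1 \<Longrightarrow> k < N"
    using breakpoint_bound[OF \<epsilon> n \<Delta>] by blast
  obtain g where g: "C \<le> 2 ^ g" "real g + 1 \<le> 6 * ln (real C)"
    using search_bound[of C] False C by auto
  let ?y = "10 * real n * ln (1 / \<Delta>) / \<epsilon>"
  have y: "real N + 1 \<le> ?y" using N(1,2) by simp
  have "real (n * ((N + 1) * ((g + 1) * (N + 1)))) = real n * ((real N + 1) * ((real g + 1) * (real N + 1)))"
    by (simp only: of_nat_mult of_nat_add of_nat_1)
  also have "\<dots> \<le> real n * (?y * ((6 * ln (real C)) * ?y))"
    using y g by (intro mult_mono mult_nonneg_nonneg) auto
  also have "\<dots> = 600 * (real n ^ 3 / \<epsilon>\<^sup>2 * (ln (1 / \<Delta>))\<^sup>2 * ln (real C))"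
    by (simp add: power2_eq_square power3_eq_cube)
  also have "\<dots> \<le> 600 * time_bound n C \<epsilon> \<Delta>" by (simp add: time_bound_def)
  finally show thesis using N g by (intro that[of N g]) auto
qed

lemma (in prob_space) fptas_correct:
  fixes X :: "nat \<Rightarrow> 'a \<Rightarrow> nat"
  assumes n: "1 \<le> n" and C: "1 \<le> C" and \<epsilon>: "0 < \<epsilon>"
    and X: "indep_vars (\<lambda>_. count_space UNIV) X {1..n}"
    and supp: "\<forall>i\<in>{1..n}. 0 \<in> supp M (X i)"
  shows "runs (interval_oracle M n X) fptas_prog (input_state n C \<epsilon>) (\<lambda>t s.
    (1 - \<epsilon>) * sum_prob M n X C \<le> result s \<and> result s \<le> (1 + \<epsilon>) * sum_prob M n X C \<and>
    real t \<le> 1200000 * time_bound n C \<epsilon> (zero_prob M n X))"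
proof -
  define Orc \<Delta> F where "Orc = interval_oracle M n X" and "\<Delta> = zero_prob M n X"
    and "F = sum_prob M n X C"
  define s where "s = input_state n C \<epsilon>"
  have n_le: "real n \<le> time_bound n C \<epsilon> \<Delta>" by (simp add: time_bound_def)
  have \<Delta>: "0 < \<Delta>" unfolding \<Delta>_def using supp by (rule zero_prob_pos)
  have F: "0 \<le> F" "F \<le> 1" by (auto simp: F_def sum_prob_def)
  have \<Delta>F: "\<Delta> \<le> F"
  proof -
    have "sum_cdf X n 0 \<le> sum_cdf X n (int C)"
      unfolding sum_cdf_def using indep_vars_measurable[OF X]
      by (intro finite_measure_mono measurable_count_sets) auto
    then show ?thesis
      using zero_prob_le_sum_cdf[OF X order_refl] by (simp add: \<Delta>_def F_def sum_prob_eq_sum_cdf)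
  qed
  have s: "reals s ''eps'' 0 = \<epsilon>" "ints s ''n'' 0 = int n" "ints s ''C'' 0 = int C" "ints s ''i'' 0 = 0"
    "ints s ''st'' 0 = 0" "ints s ''b'' 0 = 0" "reals s ''out'' 0 = 0"
    by (simp_all add: s_def input_state_def)
  have "(\<Prod>i = 1..n. Orc (int i) 0 0) = \<Delta>"
    unfolding Orc_def \<Delta>_def zero_prob_eq_prod
    by (rule prod.cong) (simp_all add: interval_oracle_eq_sum[OF X])
  then have Z: "runs Orc zero_prog s (\<lambda>t s'. t \<le> 30 * (n + 1) \<and> same_except {''i''} {''d''} s s' \<and>
      reals s' ''d'' 0 = \<Delta>)"
    using runs_zero_prog[OF s(4,2), of Orc] by simp
  have "runs Orc fptas_prog s (\<lambda>t s'. (1 - \<epsilon>) * F \<le> result s' \<and> result s' \<le> (1 + \<epsilon>) * F \<and>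
      real t \<le> 1200000 * time_bound n C \<epsilon> \<Delta>)"
  proof (cases "\<epsilon> < 1")
    case False
    then show ?thesis
      using F \<epsilon> n n_le s by (auto simp: fptas_prog_def result_def mult_nonpos_nonneg)
  next
    case True
    \<comment> \<open>The summand 10 reserves time for the outer conditional.\<close>
    have post: "runs Orc (Cond (RLess (rvar ''d'') (RSub (ROfInt (IConst 1)) (rvar ''eps'')))
           (Seq layers_prog (rset ''out'' (rvar ''v''))) (rset ''out'' (rvar ''d''))) s1
        (\<lambda>t2 s'. (1 - \<epsilon>) * F \<le> result s' \<and> result s' \<le> (1 + \<epsilon>) * F \<and>
          real (t1 + t2 + 10) \<le> 1200000 * time_bound n C \<epsilon> \<Delta>)"
      if t1: "t1 \<le> 30 * (n + 1)" and s1: "same_except {''i''} {''d''} s s1" "reals s1 ''d'' 0 = \<Delta>" for t1 s1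
    proof (cases "\<Delta> < 1 - \<epsilon>")
      case False
      \<comment> \<open>Here \<open>(1 - \<epsilon>) * F \<le> 1 - \<epsilon> \<le> \<Delta> \<le>
        F\<close>, so \<open>\<Delta>\<close> is a valid answer.\<close>
      have "(1 - \<epsilon>) * F \<le> (1 - \<epsilon>) * 1" using F True by (intro mult_left_mono) auto
      moreover have "F \<le> (1 + \<epsilon>) * F" using F \<epsilon> by (simp add: algebra_simps)
      ultimately show ?thesis
        using False s1 s t1 n n_le \<Delta>F by (auto simp: same_except_def result_def)
    next
      case less: True
      define r where "r = 1 + \<epsilon> / (2 * real n)"
      obtain N g where Ng: "1 \<le> N" "C \<le> 2 ^ g" "\<And>k. r ^ k * \<Delta> < 1 \<Longrightarrow> k \<le> C \<Longrightarrow> k < N"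
          "real (n * ((N + 1) * ((g + 1) * (N + 1)))) \<le> 600 * time_bound n C \<epsilon> \<Delta>"
        unfolding r_def using layer_parameters[OF \<epsilon> True n C \<Delta> less] by blast
      interpret layered Orc n C N g "point_prob X" "sum_cdf X" r \<Delta>
      proof
        show "1 \<le> r" using \<epsilon> by (simp add: r_def)
      qed (use Ng \<Delta> in \<open>auto simp: Orc_def \<Delta>_def interval_oracle_eq_sum[OF X] sum_cdf_0 sum_cdf_Suc[OF X]
            zero_prob_le_sum_cdf[OF X] point_prob_nonneg sum_cdf_le_1\<close>)
      let ?A = "(N + 1) * ((g + 1) * (N + 1))"
      have R: "runs Orc layers_prog s1 (\<lambda>t s'. t \<le> 50 + (n + 1) * (700 * ?A) \<and>
          reals s' ''v'' 0 \<le> F \<and> F \<le> r ^ n * reals s' ''v'' 0)"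
        unfolding F_def sum_prob_eq_sum_cdf
        using s s1 n by (intro runs_layers_prog) (auto simp: same_except_def r_def)
      have rn: "r ^ n \<le> 1 + \<epsilon>" "0 < r ^ n"
        unfolding r_def using \<epsilon> True n by (auto intro!: power_one_plus_le zero_less_power add_pos_nonneg)
      have out: "(1 - \<epsilon>) * F \<le> v \<and> v \<le> (1 + \<epsilon>) * F" if v: "v \<le> F" "F \<le> r ^ n * v" for v
      proof
        have "0 \<le> r ^ n * v" using v(2) F by linarith
        then have "0 \<le> v" using rn(2) by (simp add: zero_le_mult_iff)
        then have "F \<le> (1 + \<epsilon>) * v" using v(2) rn by (meson mult_right_mono order_trans)
        then have "(1 - \<epsilon>) * F \<le> (1 - \<epsilon>) * ((1 + \<epsilon>) * v)" using True by (intro mult_left_mono) auto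
        also have "\<dots> = v - \<epsilon>\<^sup>2 * v" by (simp add: algebra_simps power2_eq_square)
        also have "\<dots> \<le> v" using \<open>0 \<le> v\<close> by simp
        finally show "(1 - \<epsilon>) * F \<le> v" .
        have "F \<le> (1 + \<epsilon>) * F" using F \<epsilon> by (simp add: algebra_simps)
        with v show "v \<le> (1 + \<epsilon>) * F" by linarith
      qed
      \<comment> \<open>The 30 covers both conditionals and the final assignment.\<close>
      have time: "real (t1 + t2 + 30) \<le> 1200000 * time_bound n C \<epsilon> \<Delta>"
        if "t2 \<le> 50 + (n + 1) * (700 * ?A)" for t2
      proof -
        have "(n + 1) * (700 * ?A) \<le> (2 * n) * (700 * ?A)" using n by (intro mult_right_mono) auto
        also have "\<dots> = 1400 * (n * ?A)" by (simp only: mult_ac)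
        finally have "t2 \<le> 50 + 1400 * (n * ?A)" using that by linarith
        moreover have "1 \<le> ?A" by simp
        then have "n * 1 \<le> n * ?A" by (rule mult_le_mono2)
        moreover have "t1 + t2 + 30 \<le> 1600 * m" if "t2 \<le> 50 + 1400 * m" "n * 1 \<le> m" for m :: nat
          using that t1 n by simp
        ultimately have "t1 + t2 + 30 \<le> 1600 * (n * ?A)" by blast
        then have "real (t1 + t2 + 30) \<le> 1600 * real (n * ?A)"
          by (metis of_nat_le_iff of_nat_mult of_nat_numeral)
        \<comment> \<open>1600 * 600 = 960000 stays below the claimed constant.\<close>
        then show ?thesis using Ng(4) n n_le by linarith
      qed
      have b: "bval Orc s1 (RLess (rvar ''d'') (RSub (ROfInt (IConst 1)) (rvar ''eps'')))"
        using less s1 s by (simp add: same_except_def)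
      show ?thesis
        unfolding runs_Cond runs_Seq runs_RAssign if_P[OF b]
      proof (rule runs_mono[OF R], goal_cases)
        case (1 t2 s2)
        then show ?case
          using out[of "reals s2 ''v'' 0"] time[of t2] by (auto simp: result_def)
      qed
    qed
    have b: "bval Orc s (RLess (rvar ''eps'') (ROfInt (IConst 1)))"
      using True s by simp
    show ?thesis
      unfolding fptas_prog_def runs_Cond[of _ "RLess (rvar ''eps'') (ROfInt (IConst 1))"]
        runs_Seq[of _ zero_prog] if_P[OF b]
    proof (rule runs_mono[OF Z], goal_cases)
      case (1 t1 s1)
      then show ?case
        by (intro runs_mono[OF post[of t1 s1]]) auto
    qed
  qed
  then show ?thesis by (simp only: Orc_def s_def F_def \<Delta>_def)
qed

text \<open>The program and the constant are chosen before all inputs, \<open>\<epsilon>\<close>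
  included, so the bound is uniform in every parameter.\<close>

theorem theorem1:
  shows "\<exists>(P :: com) (K :: real). \<forall>(n :: nat) (C :: nat) (\<epsilon> :: real) (M :: 'a measure) (X :: nat \<Rightarrow> 'a \<Rightarrow> nat).
    1 \<le> n \<longrightarrow> 1 \<le> C \<longrightarrow> 0 < \<epsilon> \<longrightarrow>
    prob_space M \<longrightarrow>
    prob_space.indep_vars M (\<lambda>_. count_space UNIV) X {1..n} \<longrightarrow>
    (\<forall>i\<in>{1..n}. supp M (X i) \<subseteq> {0..C + 1} \<and> 0 \<in> supp M (X i)) \<longrightarrow>
    (\<exists>t s. exec (interval_oracle M n X) P (input_state n C \<epsilon>) t s \<and>
       (1 - \<epsilon>) * sum_prob M n X C \<le> result s \<and>
       result s \<le> (1 + \<epsilon>) * sum_prob M n X C \<and>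
       real t \<le> K * time_bound n C \<epsilon> (zero_prob M n X))"
proof (rule exI[of _ fptas_prog], rule exI[of _ 1200000], intro allI impI)
  fix n C :: nat and \<epsilon> :: real and M :: "'a measure" and X :: "nat \<Rightarrow> 'a \<Rightarrow> nat"
  assume "1 \<le> n" "1 \<le> C" "0 < \<epsilon>" "prob_space M"
    "prob_space.indep_vars M (\<lambda>_. count_space UNIV) X {1..n}"
    "\<forall>i\<in>{1..n}. supp M (X i) \<subseteq> {0..C + 1} \<and> 0 \<in> supp M (X i)"
  then show "\<exists>t s. exec (interval_oracle M n X) fptas_prog (input_state n C \<epsilon>) t s \<and>
       (1 - \<epsilon>) * sum_prob M n X C \<le> result s \<and>
       result s \<le> (1 + \<epsilon>) * sum_prob M n X C \<and>
       real t \<le> 1200000 * time_bound n C \<epsilon> (zero_prob M n X)"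
    using prob_space.fptas_correct[of M n C \<epsilon> X] by (simp add: runs_def)
qed

end
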